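(* Let $(\mathcal{A},\varphi)$ be a $W^*$-probability space with faithful normal tracial state $\varphi$. Assume that $f$ and $g$ are analytic functions on the unit disc. Let $U\in\mathcal{A}$ be a non-commutative variable such that $0\le U<1$, with $\eta$-transform $\eta_U$. Then $$\eta^{f,g}_U=\left[\varphi_D^U(\psi,f)\circ\varphi_D^U(\psi,g)\right]\eta_U ,$$ and $$\eta_U^f(z)=z\,\left(\left[\varphi_D^U(\psi,f)\circ D\right]\eta_U\right)(z)+\left(\varphi_D^U(\psi,f)\,\eta_U\right)(0).$$
   Context: A $W^*$-probability space is a pair $(\mathcal{A},\varphi)$ where $\mathcal{A}$ is a finite von Neumann algebra and $\varphi$ is a faithful normal tracial state. The inequalities $0\le U<1$ are between self-adjoint elements, $1$ being the unit of $\mathcal{A}$. For $f(z)=\sum_{i\ge0}a_iz^i$, $f(U)=\sum_{i\ge0}a_iU^i$, and similarly for $g$. Boolean cumulants $\beta_n:\mathcal{A}^n\to\mathbb{C}$ are defined recursively by $$\varphi(X_1\cdots X_m)=\sum_{\pi\in Int(m)}\ \prod_{B\in\pi}\beta_{|B|}(X_i;\,i\in B),\qquad m\ge1,$$ where $Int(m)$ is the set of interval partitions of $\{1,\dots,m\}$ (all blocks consist of consecutive integers), with arguments in each block in increasing order of indices. Write $\beta_n(U)=\beta_n(U,\ldots,U)$. The $\eta$-transform is $\eta_U(z)=\frac{M_U(z)}{1+M_U(z)}=\sum_{n\ge1}\beta_n(U)z^n$ near $0$, where $M_U(z)=\sum_{n\ge1}\varphi(U^n)z^n$ near $0$. Further,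 $$\eta^{f,g}_U(z)=\sum_{\ell\ge0}\beta_{\ell+2}(f(U),\underbrace{U,\ldots,U}_{\ell},g(U))z^\ell,\qquad \eta^f_U(z)=\sum_{\ell\ge0}\beta_{\ell+1}(f(U),\underbrace{U,\ldots,U}_{\ell})z^\ell .$$ $\psi$ is the formal power series $\psi(x)=\sum_{k\ge1}x^k$. $D$ is the zero derivative on complex power series: the linear operator with $Dz^k=z^{k-1}$ for $k\ge1$ and $D1=0$. $\mathbf{D}$ is the analogous linear operator on power series in an algebra variable $T$: $\mathbf{D}T^k=T^{k-1}$ for $k\ge1$ and $\mathbf{D}T^0=0$; thus $\mathbf{D}^kf(T)=\sum_{i\ge k}a_iT^{i-k}$. For a formal power series $H(T)=\sum_{k\ge0}h_kT^k$ and a power series $f$ one defines the operator, acting on complex functions (power series), $$\varphi_D^T(H,f)=\sum_{k\ge0}h_k\,\varphi\left(\mathbf{D}^kf(T)\right)D^k,$$ so that $\varphi_D^U(\psi,f)=\sum_{k\ge1}\varphi(\mathbf{D}^kf(U))D^k$. The result of applying it to an analytic function is in general a formal series.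
   Formalization: The second identity as printed fails when f(0) ≠ 0 (e.g. f = 1, U = 0 gives 1 = 0); it is proved as printed for f(0) = 0, and for every analytic f with the missing constant f(0) added to the right-hand side. *)

theory Defs
  imports
    "HOL-Complex_Analysis.Complex_Analysis"
    "HOL-Library.Disjoint_Sets"
    "HOL-Library.Nonpos_Ints"
begin

section \<open>Complex Hilbert spaces\<close>

text \<open>The real inner product, and hence the norm and the topology, is the one underlying the
  complex inner product, which is linear in its first argument.\<close>

class complex_hilbert_space = real_inner + banach +
  fixes scaleC :: "complex \<Rightarrow> 'a \<Rightarrow> 'a"  (infixr \<open>*\<^sub>C\<close> 75)
    and cinner :: "'a \<Rightarrow> 'a \<Rightarrow> complex"
  assumes scaleC_of_real: "of_real r *\<^sub>C x = r *\<^sub>R x"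
    and scaleC_scaleC: "c *\<^sub>C (d *\<^sub>C x) = (c * d) *\<^sub>C x"
    and scaleC_add_right: "c *\<^sub>C (x + y) = c *\<^sub>C x + c *\<^sub>C y"
    and scaleC_add_left: "(c + d) *\<^sub>C x = c *\<^sub>C x + d *\<^sub>C x"
    and cinner_add_left: "cinner (x + y) z = cinner x z + cinner y z"
    and cinner_scaleC_left: "cinner (c *\<^sub>C x) y = c * cinner x y"
    and cinner_commute: "cinner x y = cnj (cinner y x)"
    and inner_eq_Re_cinner: "inner x y = Re (cinner x y)"

lemma norm_scaleC:
  fixes x :: "'a::complex_hilbert_space"
  shows "norm (c *\<^sub>C x) = cmod c * norm x"
proof -
  have "cinner (c *\<^sub>C x) (c *\<^sub>C x) = c * cnj (c * cinner x x)"
    by (metis cinner_commute cinner_scaleC_left)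
  also have "\<dots> = (c * cnj c) * cinner x x"
    using cinner_commute [of x x] by simp
  also have "\<dots> = of_real ((cmod c)\<^sup>2) * cinner x x"
    by (simp only: complex_norm_square)
  finally have "(norm (c *\<^sub>C x))\<^sup>2 = (cmod c * norm x)\<^sup>2"
    by (simp add: power2_norm_eq_inner inner_eq_Re_cinner power_mult_distrib del: of_real_power)
  then show ?thesis
    by (simp add: power2_eq_iff_nonneg)
qed

lemma bounded_linear_scaleC:
  "bounded_linear (\<lambda>x :: 'a::complex_hilbert_space. c *\<^sub>C x)"
proof (rule bounded_linear_intro [where K = "cmod c"])
  show "c *\<^sub>C (x + y) = c *\<^sub>C x + c *\<^sub>C y" for x y :: 'a
    by (rule scaleC_add_right)
  show "c *\<^sub>C (r *\<^sub>R x) = r *\<^sub>R (c *\<^sub>C x)" for r and x :: 'a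
    by (simp add: scaleC_scaleC mult.commute flip: scaleC_of_real)
  show "norm (c *\<^sub>C x) \<le> norm x * cmod c" for x :: 'a
    by (simp add: norm_scaleC mult.commute)
qed


section \<open>Operators and von Neumann algebras\<close>

text \<open>The type \<^typ>\<open>'h \<Rightarrow>\<^sub>L 'h\<close> consists of all bounded real-linear operators;
  the algebra of bounded operators of the complex Hilbert space is the following subset of it.\<close>

definition complex_operators :: "('h::complex_hilbert_space \<Rightarrow>\<^sub>L 'h) set" where
  "complex_operators = {A. \<forall>c x. blinfun_apply A (c *\<^sub>C x) = c *\<^sub>C blinfun_apply A x}"

definition scaleC_op ::
    "complex \<Rightarrow> ('h::complex_hilbert_space \<Rightarrow>\<^sub>L 'h) \<Rightarrow> ('h \<Rightarrow>\<^sub>L 'h)" where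
  "scaleC_op c A = Blinfun (\<lambda>x. c *\<^sub>C A x)"

lemma scaleC_op_apply [simp]: "scaleC_op c A x = c *\<^sub>C A x"
  unfolding scaleC_op_def
  by (simp add: bounded_linear_Blinfun_apply
      bounded_linear_compose [OF bounded_linear_scaleC blinfun.bounded_linear_right])

definition op_power :: "('h::real_normed_vector \<Rightarrow>\<^sub>L 'h) \<Rightarrow> nat \<Rightarrow> ('h \<Rightarrow>\<^sub>L 'h)" where
  "op_power A n = ((o\<^sub>L) A ^^ n) id_blinfun"

definition op_prod_list :: "('h::real_normed_vector \<Rightarrow>\<^sub>L 'h) list \<Rightarrow> ('h \<Rightarrow>\<^sub>L 'h)" where
  "op_prod_list Xs = foldr (o\<^sub>L) Xs id_blinfun"

definition is_adjoint ::
    "('h::complex_hilbert_space \<Rightarrow>\<^sub>L 'h) \<Rightarrow> ('h \<Rightarrow>\<^sub>L 'h) \<Rightarrow> bool" where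
  "is_adjoint A B \<longleftrightarrow> (\<forall>x y. cinner (A x) y = cinner x (B y))"

definition self_adjoint :: "('h::complex_hilbert_space \<Rightarrow>\<^sub>L 'h) \<Rightarrow> bool" where
  "self_adjoint A \<longleftrightarrow> is_adjoint A A"

definition positive_op :: "('h::complex_hilbert_space \<Rightarrow>\<^sub>L 'h) \<Rightarrow> bool" where
  "positive_op A \<longleftrightarrow> self_adjoint A \<and> (\<forall>x. cinner (A x) x \<in> \<real>\<^sub>\<ge>\<^sub>0)"

definition op_le :: "('h::complex_hilbert_space \<Rightarrow>\<^sub>L 'h) \<Rightarrow> ('h \<Rightarrow>\<^sub>L 'h) \<Rightarrow> bool" where
  "op_le A B \<longleftrightarrow> positive_op (B - A)"

text \<open>The strict order of self-adjoint elements: the difference is positive and invertible.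
  Thus \<open>0 \<le> U < 1\<close> says that the spectrum of \<open>U\<close> is contained in \<open>[0, 1)\<close>, which
  is what makes a power series on the unit disc convergent at \<open>U\<close>.\<close>

definition op_less :: "('h::complex_hilbert_space \<Rightarrow>\<^sub>L 'h) \<Rightarrow> ('h \<Rightarrow>\<^sub>L 'h) \<Rightarrow> bool" where
  "op_less A B \<longleftrightarrow> op_le A B \<and>
     (\<exists>C. (B - A) o\<^sub>L C = id_blinfun \<and> C o\<^sub>L (B - A) = id_blinfun)"

definition commutant ::
    "('h::complex_hilbert_space \<Rightarrow>\<^sub>L 'h) set \<Rightarrow> ('h \<Rightarrow>\<^sub>L 'h) set" where
  "commutant S = {A \<in> complex_operators. \<forall>B\<in>S. A o\<^sub>L B = B o\<^sub>L A}"

definition von_neumann_algebra :: "('h::complex_hilbert_space \<Rightarrow>\<^sub>L 'h) set \<Rightarrow> bool" where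
  "von_neumann_algebra \<A> \<longleftrightarrow>
     \<A> \<subseteq> complex_operators \<and>
     (\<forall>A\<in>\<A>. \<exists>B\<in>\<A>. is_adjoint A B) \<and>
     commutant (commutant \<A>) = \<A>"

text \<open>Finiteness: every isometry in the algebra is unitary.\<close>

definition finite_von_neumann_algebra ::
    "('h::complex_hilbert_space \<Rightarrow>\<^sub>L 'h) set \<Rightarrow> bool" where
  "finite_von_neumann_algebra \<A> \<longleftrightarrow>
     von_neumann_algebra \<A> \<and>
     (\<forall>A\<in>\<A>. \<forall>B\<in>\<A>. is_adjoint A B \<and> B o\<^sub>L A = id_blinfun \<longrightarrow>
        A o\<^sub>L B = id_blinfun)"


section \<open>Faithful normal tracial states\<close>

definition state_on ::
    "('h::complex_hilbert_space \<Rightarrow>\<^sub>L 'h) set \<Rightarrow> (('h \<Rightarrow>\<^sub>L 'h) \<Rightarrow> complex) \<Rightarrow> bool" where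
  "state_on \<A> \<phi> \<longleftrightarrow>
     (\<forall>A\<in>\<A>. \<forall>B\<in>\<A>. \<phi> (A + B) = \<phi> A + \<phi> B) \<and>
     (\<forall>c. \<forall>A\<in>\<A>. \<phi> (scaleC_op c A) = c * \<phi> A) \<and>
     (\<forall>A\<in>\<A>. positive_op A \<longrightarrow> \<phi> A \<in> \<real>\<^sub>\<ge>\<^sub>0) \<and>
     \<phi> id_blinfun = 1"

definition tracial_on ::
    "('h::complex_hilbert_space \<Rightarrow>\<^sub>L 'h) set \<Rightarrow> (('h \<Rightarrow>\<^sub>L 'h) \<Rightarrow> complex) \<Rightarrow> bool" where
  "tracial_on \<A> \<phi> \<longleftrightarrow> (\<forall>A\<in>\<A>. \<forall>B\<in>\<A>. \<phi> (A o\<^sub>L B) = \<phi> (B o\<^sub>L A))"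

definition faithful_on ::
    "('h::complex_hilbert_space \<Rightarrow>\<^sub>L 'h) set \<Rightarrow> (('h \<Rightarrow>\<^sub>L 'h) \<Rightarrow> complex) \<Rightarrow> bool" where
  "faithful_on \<A> \<phi> \<longleftrightarrow> (\<forall>A\<in>\<A>. positive_op A \<and> \<phi> A = 0 \<longrightarrow> A = 0)"

text \<open>Normality: the functional preserves least upper bounds of upward directed sets of
  self-adjoint elements.\<close>

definition normal_on ::
    "('h::complex_hilbert_space \<Rightarrow>\<^sub>L 'h) set \<Rightarrow> (('h \<Rightarrow>\<^sub>L 'h) \<Rightarrow> complex) \<Rightarrow> bool" where
  "normal_on \<A> \<phi> \<longleftrightarrow>
     (\<forall>S A. S \<subseteq> {X \<in> \<A>. self_adjoint X} \<and> S \<noteq> {} \<and>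
        (\<forall>X\<in>S. \<forall>Y\<in>S. \<exists>Z\<in>S. op_le X Z \<and> op_le Y Z) \<and>
        A \<in> \<A> \<and> self_adjoint A \<and> (\<forall>X\<in>S. op_le X A) \<and>
        (\<forall>B\<in>\<A>. self_adjoint B \<and> (\<forall>X\<in>S. op_le X B) \<longrightarrow> op_le A B) \<longrightarrow>
        Re (\<phi> A) = (SUP X\<in>S. Re (\<phi> X)))"

definition W_star_probability_space ::
    "('h::complex_hilbert_space \<Rightarrow>\<^sub>L 'h) set \<Rightarrow> (('h \<Rightarrow>\<^sub>L 'h) \<Rightarrow> complex) \<Rightarrow> bool" where
  "W_star_probability_space \<A> \<phi> \<longleftrightarrow>
     finite_von_neumann_algebra \<A> \<and>
     state_on \<A> \<phi> \<and> faithful_on \<A> \<phi> \<and> normal_on \<A> \<phi> \<and> tracial_on \<A> \<phi>"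


section \<open>Boolean cumulants\<close>

text \<open>Positions in a list of length \<open>m\<close> are counted from \<open>0\<close>, so the interval partitions
  are those of \<open>{0, \<dots>, m - 1}\<close>.\<close>

definition interval_partitions :: "nat \<Rightarrow> nat set set set" where
  "interval_partitions m =
     {\<pi>. partition_on {..<m} \<pi> \<and> (\<forall>B\<in>\<pi>. \<exists>i j. B = {i..j})}"

lemma finite_interval_partitions: "finite (interval_partitions m)"
  by (rule finite_subset [of _ "Pow (Pow {..<m})"])
    (auto simp: interval_partitions_def partition_on_def)

lemma whole_in_interval_partitions:
  assumes "m > 0"
  shows "{{..<m}} \<in> interval_partitions m"
proof -
  from assms have "{..<m} = {0..m - 1}" "{..<m} \<noteq> {}"
    by auto
  then show ?thesis
    unfolding interval_partitions_def using partition_on_space by blast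
qed

lemma length_nths_proper_block:
  assumes "\<pi> \<in> interval_partitions (length Xs) - {{{..<length Xs}}}" "B \<in> \<pi>"
  shows "length (nths Xs B) < length Xs"
proof -
  from assms have part: "partition_on {..<length Xs} \<pi>" and ne: "\<pi> \<noteq> {{..<length Xs}}"
    by (auto simp: interval_partitions_def)
  have sub: "B \<subseteq> {..<length Xs}"
    using part assms(2) by (auto simp: partition_on_def)
  have "B \<noteq> {..<length Xs}"
  proof
    assume whole: "B = {..<length Xs}"
    have "C = B" if "C \<in> \<pi>" for C
    proof (rule ccontr)
      assume "C \<noteq> B"
      then have "C \<inter> B = {}"
        using part that assms(2) by (auto simp: partition_on_def disjoint_def)
      moreover have "C \<subseteq> B" "C \<noteq> {}"
        using part that whole by (auto simp: partition_on_def)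
      ultimately show False by blast
    qed
    then have "\<pi> = {{..<length Xs}}"
      using assms(2) whole by blast
    with ne show False ..
  qed
  with sub have "B \<subset> {..<length Xs}" by blast
  then have "card B < length Xs"
    using psubset_card_mono [of "{..<length Xs}" B] by simp
  moreover have "{i. i < length Xs \<and> i \<in> B} = B"
    using sub by auto
  ultimately show ?thesis
    by (simp add: length_nths)
qed

text \<open>The moment-cumulant formula \<open>boolean_moment_cumulant\<close> below, solved for the term
  of the partition with a single block.\<close>

function boolean_cumulant ::
    "(('h::real_normed_vector \<Rightarrow>\<^sub>L 'h) \<Rightarrow> complex) \<Rightarrow> ('h \<Rightarrow>\<^sub>L 'h) list \<Rightarrow> complex" where
  "boolean_cumulant \<phi> Xs =
     \<phi> (op_prod_list Xs) -
     (\<Sum>\<pi> \<in> interval_partitions (length Xs) - {{{..<length Xs}}}.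
        \<Prod>B\<in>\<pi>. boolean_cumulant \<phi> (nths Xs B))"
  by auto
termination
  by (relation "Wellfounded.measure (\<lambda>(\<phi>, Xs). length Xs)") (auto intro: length_nths_proper_block)

declare boolean_cumulant.simps [simp del]

lemma boolean_moment_cumulant:
  assumes "Xs \<noteq> []"
  shows "\<phi> (op_prod_list Xs) =
     (\<Sum>\<pi> \<in> interval_partitions (length Xs). \<Prod>B\<in>\<pi>. boolean_cumulant \<phi> (nths Xs B))"
proof -
  have "nths Xs {..<length Xs} = Xs"
    by (simp add: nths_all)
  then show ?thesis
    using assms boolean_cumulant.simps [of \<phi> Xs]
    by (simp add: sum.remove [OF finite_interval_partitions whole_in_interval_partitions])
qed


section \<open>The eta transforms\<close>

text \<open>Power series at an operator; the series converges in operator norm. For \<open>f\<close> analytic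
  on the unit disc, \<open>f(U)\<close> is \<open>fps_op (fps_expansion f 0) U\<close>.\<close>

definition fps_op ::
    "complex fps \<Rightarrow> ('h::complex_hilbert_space \<Rightarrow>\<^sub>L 'h) \<Rightarrow> ('h \<Rightarrow>\<^sub>L 'h)" where
  "fps_op F U = (\<Sum>i. scaleC_op (fps_nth F i) (op_power U i))"

definition moment_fps ::
    "(('h::complex_hilbert_space \<Rightarrow>\<^sub>L 'h) \<Rightarrow> complex) \<Rightarrow> ('h \<Rightarrow>\<^sub>L 'h) \<Rightarrow> complex fps" where
  "moment_fps \<phi> U = Abs_fps (\<lambda>n. if n = 0 then 0 else \<phi> (op_power U n))"

text \<open>All transforms are identified with their power series at \<open>0\<close>.\<close>

definition eta ::
    "(('h::complex_hilbert_space \<Rightarrow>\<^sub>L 'h) \<Rightarrow> complex) \<Rightarrow> ('h \<Rightarrow>\<^sub>L 'h) \<Rightarrow> complex fps" where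
  "eta \<phi> U = moment_fps \<phi> U / (1 + moment_fps \<phi> U)"

definition eta1 ::
    "(('h::complex_hilbert_space \<Rightarrow>\<^sub>L 'h) \<Rightarrow> complex) \<Rightarrow> complex fps \<Rightarrow> ('h \<Rightarrow>\<^sub>L 'h) \<Rightarrow> complex fps"
  where
  "eta1 \<phi> F U = Abs_fps (\<lambda>l. boolean_cumulant \<phi> (fps_op F U # replicate l U))"

definition eta2 ::
    "(('h::complex_hilbert_space \<Rightarrow>\<^sub>L 'h) \<Rightarrow> complex) \<Rightarrow> complex fps \<Rightarrow> complex fps \<Rightarrow>
     ('h \<Rightarrow>\<^sub>L 'h) \<Rightarrow> complex fps" where
  "eta2 \<phi> F G U =
     Abs_fps (\<lambda>l. boolean_cumulant \<phi> (fps_op F U # replicate l U @ [fps_op G U]))"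


section \<open>The operators built from the zero derivative\<close>

definition zero_deriv :: "complex fps \<Rightarrow> complex fps" where
  "zero_deriv = fps_shift 1"

definition psi :: "complex fps" where
  "psi = Abs_fps (\<lambda>k. if k = 0 then 0 else 1)"

text \<open>The \<open>k\<close>-th term of the infinite sum defining \<open>\<phi>\<^sub>D\<^sup>T(H, F)\<close>, applied to the
  power series \<open>G\<close>; the zero derivative in the variable \<open>T\<close> is the same shift of
  coefficients as the one in \<open>z\<close>. The infinite sum is taken coefficientwise in \<open>\<complex>\<close>; its existence is
  recorded separately in \<open>phi_D_converges\<close>.\<close>

definition phi_D_term ::
    "(('h::complex_hilbert_space \<Rightarrow>\<^sub>L 'h) \<Rightarrow> complex) \<Rightarrow> ('h \<Rightarrow>\<^sub>L 'h) \<Rightarrow>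
     complex fps \<Rightarrow> complex fps \<Rightarrow> complex fps \<Rightarrow> nat \<Rightarrow> complex fps" where
  "phi_D_term \<phi> T H F G k =
     fps_const (fps_nth H k * \<phi> (fps_op ((zero_deriv ^^ k) F) T)) * (zero_deriv ^^ k) G"

definition phi_D_converges ::
    "(('h::complex_hilbert_space \<Rightarrow>\<^sub>L 'h) \<Rightarrow> complex) \<Rightarrow> ('h \<Rightarrow>\<^sub>L 'h) \<Rightarrow>
     complex fps \<Rightarrow> complex fps \<Rightarrow> complex fps \<Rightarrow> bool" where
  "phi_D_converges \<phi> T H F G \<longleftrightarrow>
     (\<forall>n. summable (\<lambda>k. fps_nth (phi_D_term \<phi> T H F G k) n))"

definition phi_D ::
    "(('h::complex_hilbert_space \<Rightarrow>\<^sub>L 'h) \<Rightarrow> complex) \<Rightarrow> ('h \<Rightarrow>\<^sub>L 'h) \<Rightarrow>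
     complex fps \<Rightarrow> complex fps \<Rightarrow> complex fps \<Rightarrow> complex fps" where
  "phi_D \<phi> T H F G = Abs_fps (\<lambda>n. \<Sum>k. fps_nth (phi_D_term \<phi> T H F G k) n)"

end

theory Submission
  imports Defs
begin

text \<open>Splitting an interval partition at its first block turns the moment-cumulant formula into
  convolution identities: with \<open>S = 1 + M\<^sub>U\<close>, \<open>M\<^sup>f = \<Sum>\<^sub>l \<phi>(f(U) U\<^sup>l) z\<^sup>l\<close> and
  \<open>M\<^bsup>f,g\<^esup> = \<Sum>\<^sub>l \<phi>(f(U) U\<^sup>l g(U)) z\<^sup>l\<close> one has \<open>M\<^sup>f = \<eta>\<^sup>f S\<close> and \<open>M\<^bsup>f,g\<^esup> = \<eta>\<^bsup>f,g\<^esup> + \<eta>\<^sup>f M\<^sup>g\<close>. Substituting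
  \<open>f(U) = f(0) + U (D f)(U)\<close> gives, with \<open>c = \<phi>((D f)(U))\<close>, the one-step recursions
  \<open>\<eta>\<^sup>f = f(0) + D (c \<eta> + \<eta>\<^bsup>Df\<^esup>)\<close> and \<open>\<eta>\<^bsup>f,g\<^esup> = D (c \<eta>\<^sup>g + \<eta>\<^bsup>Df,g\<^esup>)\<close>; iterating them produces the partial
  sums of the zero-derivative operators. The remainder tends to \<open>0\<close>: the spectral gap gives
  \<open>\<parallel>U\<parallel> \<le> r < 1\<close>, the moments of \<open>U\<close> are log-convex, and Kaluza's theorem then bounds the
  coefficients of \<open>\<eta>\<close> by \<open>r\<^sup>n\<close>.\<close>

section \<open>The first block of an interval partition\<close>

lemma inj_image_translation: "inj_on ((`) ((+) (j::nat))) A"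
  by (simp add: inj_on_def inj_image_eq_iff)

text \<open>The translated blocks partition \<open>{j..<m}\<close>, so the new initial block is
  disjoint from them. As \<open>0 < j\<close> makes it nonempty, it is also different from each of
  them, which later lets it be split off a product over the blocks.\<close>

lemma interval_partitions_insert:
  assumes "0 < j" "j \<le> m" "\<pi> \<in> interval_partitions (m - j)"
  shows "insert {..<j} ((`) ((+) j) ` \<pi>) \<in> interval_partitions m"
    and "{..<j} \<notin> (`) ((+) j) ` \<pi>"
proof -
  have part: "partition_on {..<m - j} \<pi>" and iv: "\<forall>B\<in>\<pi>. \<exists>a b. B = {a..b}"
    using assms(3) by (auto simp: interval_partitions_def)
  have "(+) j ` {..<m - j} = {j..<m}"
    using assms(2) by (simp add: lessThan_atLeast0 image_add_atLeastLessThan)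
  moreover have "{} \<notin> (`) ((+) j) ` \<pi>"
    using partition_onD3[OF part] by auto
  ultimately have p1: "partition_on {j..<m} ((`) ((+) j) ` \<pi>)"
    using partition_on_inj_image[OF part, of "(+) j"] \<open>{} \<notin> (`) ((+) j) ` \<pi>\<close> by simp
  have "partition_on {..<m} (insert {..<j} ((`) ((+) j) ` \<pi>))"
  proof (rule partition_onI)
    have "\<Union> (insert {..<j} ((`) ((+) j) ` \<pi>)) = {..<j} \<union> {j..<m}"
      by (simp add: partition_onD1[OF p1])
    then show "\<Union> (insert {..<j} ((`) ((+) j) ` \<pi>)) = {..<m}"
      using assms(2) by auto
  next
    fix p q assume "p \<in> insert {..<j} ((`) ((+) j) ` \<pi>)" "q \<in> insert {..<j} ((`) ((+) j) ` \<pi>)" "p \<noteq> q"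
    then show "disjnt p q"
      using partition_onD2[OF p1] by (auto simp: disjoint_def disjnt_def)
  qed (use partition_onD3[OF p1] assms in auto)
  moreover have "\<exists>a b. B = {a..b}" if B: "B \<in> insert {..<j} ((`) ((+) j) ` \<pi>)" for B
  proof (cases "B = {..<j}")
    case True
    then have "B = {0..j - 1}" using assms(1) by auto
    then show ?thesis by blast
  next
    case False
    then obtain C where "C \<in> \<pi>" "B = (+) j ` C" using B by auto
    then show ?thesis using iv by (metis image_add_atLeastAtMost)
  qed
  ultimately show "insert {..<j} ((`) ((+) j) ` \<pi>) \<in> interval_partitions m"
    by (auto simp: interval_partitions_def)
  show "{..<j} \<notin> (`) ((+) j) ` \<pi>"
    using partition_onD1[OF p1] assms(1) by auto
qed

text \<open>The block containing 0 is an initial segment \<open>{..<j}\<close>; its length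
  \<open>j\<close> and the remaining blocks, translated down by \<open>j\<close>, determine the
  partition.\<close>

lemma bij_betw_interval_partitions_first_block:
  assumes "0 < m"
  shows "bij_betw (\<lambda>(j, \<pi>). insert {..<j} ((`) ((+) j) ` \<pi>))
    (SIGMA j:{1..m}. interval_partitions (m - j)) (interval_partitions m)"
proof (rule bij_betwI')
  fix x y
  assume "x \<in> (SIGMA j:{1..m}. interval_partitions (m - j))"
    and "y \<in> (SIGMA j:{1..m}. interval_partitions (m - j))"
  then obtain j \<pi> k \<rho> where x: "x = (j, \<pi>)" and y: "y = (k, \<rho>)"
    and j: "0 < j" "j \<le> m" "\<pi> \<in> interval_partitions (m - j)"
    and k: "0 < k" "k \<le> m" "\<rho> \<in> interval_partitions (m - k)"
    by auto
  show "((\<lambda>(j, \<pi>). insert {..<j} ((`) ((+) j) ` \<pi>)) x =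
      (\<lambda>(j, \<pi>). insert {..<j} ((`) ((+) j) ` \<pi>)) y) = (x = y)"
  proof
    assume "(\<lambda>(j, \<pi>). insert {..<j} ((`) ((+) j) ` \<pi>)) x =
      (\<lambda>(j, \<pi>). insert {..<j} ((`) ((+) j) ` \<pi>)) y"
    then have eq: "insert {..<j} ((`) ((+) j) ` \<pi>) = insert {..<k} ((`) ((+) k) ` \<rho>)"
      by (simp add: x y)
    have "{..<j} \<in> insert {..<k} ((`) ((+) k) ` \<rho>)"
      using eq by blast
    \<comment> \<open>Blocks translated by \<open>k > 0\<close> miss 0, while \<open>{..<j}\<close>
      contains it. So \<open>{..<j}\<close> can only be the inserted block \<open>{..<k}\<close>,
      which forces \<open>j = k\<close>.\<close>
    moreover have "{..<j} \<notin> (`) ((+) k) ` \<rho>"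
    proof
      assume "{..<j} \<in> (`) ((+) k) ` \<rho>"
      then obtain C where "{..<j} = (+) k ` C" by blast
      then have "0 \<in> (+) k ` C" using j(1) by auto
      then show False using k(1) by auto
    qed
    ultimately have jk: "j = k" by auto
    have "(`) ((+) j) ` \<pi> = (`) ((+) j) ` \<rho>"
      using eq interval_partitions_insert(2)[OF j] interval_partitions_insert(2)[OF k]
      unfolding jk by (metis insert_ident)
    then have "\<pi> = \<rho>"
      by (simp add: inj_image_eq_iff inj_image_translation)
    then show "x = y" by (simp add: x y jk)
  qed simp
next
  fix x assume "x \<in> (SIGMA j:{1..m}. interval_partitions (m - j))"
  then show "(\<lambda>(j, \<pi>). insert {..<j} ((`) ((+) j) ` \<pi>)) x \<in> interval_partitions m"
    by (auto simp: interval_partitions_insert)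
next
  fix \<pi> assume pi: "\<pi> \<in> interval_partitions m"
  then have part: "partition_on {..<m} \<pi>" and iv: "\<forall>B\<in>\<pi>. \<exists>a b. B = {a..b}"
    by (auto simp: interval_partitions_def)
  obtain B where B: "B \<in> \<pi>" "0 \<in> B"
    using partition_onD1[OF part] assms by blast
  then obtain b where "B = {0..b}" using iv by force
  then obtain j where Bj: "B = {..<j}" and j: "0 < j"
    by (metis atLeast0AtMost lessThan_Suc_atMost zero_less_Suc)
  have "j \<le> m"
    using B(1) partition_onD1[OF part] Bj by (metis UnionI lessThan_subset_iff subsetI)
  have above: "C \<subseteq> {j..<m}" if "C \<in> \<pi> - {B}" for C
  proof -
    have "C \<inter> {..<j} = {}"
      using partition_onD2[OF part] that B(1) Bj by (auto simp: disjoint_def)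
    moreover have "C \<subseteq> {..<m}" using partition_onD1[OF part] that by blast
    ultimately show ?thesis by (auto simp: not_less[symmetric])
  qed
  \<comment> \<open>Adding \<open>j\<close> undoes the truncated subtraction only because every
    remaining block lies in \<open>{j..<m}\<close>.\<close>
  have shift_back: "(+) j ` (\<lambda>i. i - j) ` C = C" if "C \<in> \<pi> - {B}" for C
  proof -
    have "j + (i - j) = i" if "i \<in> C" for i using above[OF \<open>C \<in> \<pi> - {B}\<close>] that by auto
    then show ?thesis by (simp add: image_image)
  qed
  have inj: "inj_on (\<lambda>i. i - j) {j..<m}" by (auto simp: inj_on_def)
  define \<rho> where "\<rho> = (`) (\<lambda>i. i - j) ` (\<pi> - {B})"
  have "partition_on {j..<m} (\<pi> - {B})"
  proof (rule partition_onI)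
    have "x \<in> \<Union> (\<pi> - {B})" if "x \<in> {j..<m}" for x
    proof -
      have "x \<in> {..<m}" "x \<notin> B" using that Bj by auto
      then show ?thesis using partition_onD1[OF part] by blast
    qed
    then show "\<Union> (\<pi> - {B}) = {j..<m}" using above by blast
  qed (use part in \<open>auto simp: partition_on_def disjoint_def disjnt_def\<close>)
  from partition_on_inj_image[OF this inj]
  have "partition_on ((\<lambda>i. i - j) ` {j..<m}) (\<rho> - {{}})"
    by (simp add: \<rho>_def)
  moreover have "(\<lambda>i. i - j) ` {j..<m} = {..<m - j}"
    by (simp add: lessThan_atLeast0 image_minus_const_atLeastLessThan_nat)
  moreover have "{} \<notin> \<rho>" using partition_onD3[OF part] by (auto simp: \<rho>_def)
  ultimately have "partition_on {..<m - j} \<rho>" by simp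
  moreover have "\<exists>a b. C = {a..b}" if C: "C \<in> \<rho>" for C
  proof -
    from C obtain C' where C': "C' \<in> \<pi> - {B}" "C = (\<lambda>i. i - j) ` C'" by (auto simp: \<rho>_def)
    then obtain a b where ab: "C' = {a..b}" using iv by blast
    \<comment> \<open>An interval with \<open>a > b\<close> would be empty. As blocks are nonempty,
      \<open>a\<close> really belongs to the block, whence \<open>j \<le> a\<close>.\<close>
    have "a \<le> b"
      using partition_onD3[OF part] C'(1) unfolding ab by (metis DiffD1 atLeastatMost_empty_iff)
    then have "j \<le> a"
      using above[OF C'(1)] unfolding ab by (auto simp: subset_iff)
    then have "C = {a - j..b - j}"
    proof -
      have "C' = (+) j ` {a - j..b - j}" using ab \<open>j \<le> a\<close> \<open>a \<le> b\<close> by simp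
      then have "C = (\<lambda>i. j + i - j) ` {a - j..b - j}" unfolding C'(2) by (simp only: image_image)
      then show ?thesis by simp
    qed
    then show ?thesis by blast
  qed
  ultimately have "\<rho> \<in> interval_partitions (m - j)"
    by (auto simp: interval_partitions_def)
  moreover have "(`) ((+) j) ` \<rho> = \<pi> - {B}"
    using shift_back by (simp add: \<rho>_def image_image[of "(`) ((+) j)"])
  then have "\<pi> = insert {..<j} ((`) ((+) j) ` \<rho>)"
    using B(1) Bj by blast
  ultimately show "\<exists>x\<in>(SIGMA j:{1..m}. interval_partitions (m - j)).
      \<pi> = (\<lambda>(j, \<pi>). insert {..<j} ((`) ((+) j) ` \<pi>)) x"
    using j \<open>j \<le> m\<close> by (intro bexI[of _ "(j, \<rho>)"]) auto
qed

lemma interval_partitions_0: "interval_partitions 0 = {{}}"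
  by (auto simp: interval_partitions_def partition_on_empty)

text \<open>For a fixed first block, the sum over the remaining blocks is again a moment-cumulant
  sum, namely that of \<open>drop j Xs\<close>. The value 1 at the identity covers
  \<open>j = length Xs\<close>, where the remaining word is empty and its only partition is the
  empty one.\<close>

lemma boolean_moment_cumulant_first_block:
  assumes "Xs \<noteq> []" "\<phi> id_blinfun = 1"
  shows "\<phi> (op_prod_list Xs) =
    (\<Sum>j=1..length Xs. boolean_cumulant \<phi> (take j Xs) * \<phi> (op_prod_list (drop j Xs)))"
proof -
  let ?m = "length Xs"
  let ?w = "\<lambda>Ys \<pi>. \<Prod>B\<in>\<pi>. boolean_cumulant \<phi> (nths Ys B)"
  have moment: "\<phi> (op_prod_list Ys) = sum (?w Ys) (interval_partitions (length Ys))" for Ys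
  proof (cases "Ys = []")
    case True
    then show ?thesis using assms(2) by (simp add: interval_partitions_0 op_prod_list_def)
  qed (rule boolean_moment_cumulant)
  have split: "?w Xs (insert {..<j} ((`) ((+) j) ` \<pi>)) =
      boolean_cumulant \<phi> (take j Xs) * ?w (drop j Xs) \<pi>"
    if "j \<in> {1..?m}" "\<pi> \<in> interval_partitions (?m - j)" for j \<pi>
  proof -
    have "finite \<pi>"
      using that(2) finite_elements[of "{..<?m - j}" \<pi>] by (auto simp: interval_partitions_def)
    then have "?w Xs (insert {..<j} ((`) ((+) j) ` \<pi>)) =
      boolean_cumulant \<phi> (nths Xs {..<j}) * ?w Xs ((`) ((+) j) ` \<pi>)"
      using interval_partitions_insert(2)[of j ?m \<pi>] that by simp
    then show ?thesis
      by (simp add: prod.reindex inj_image_translation nths_drop)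
  qed
  have "\<phi> (op_prod_list Xs) = (\<Sum>x\<in>(SIGMA j:{1..?m}. interval_partitions (?m - j)).
      ?w Xs ((\<lambda>(j, \<pi>). insert {..<j} ((`) ((+) j) ` \<pi>)) x))"
    unfolding moment using assms(1)
    by (intro sum.reindex_bij_betw[OF bij_betw_interval_partitions_first_block, symmetric]) simp
  also have "\<dots> = (\<Sum>(j, \<pi>)\<in>(SIGMA j:{1..?m}. interval_partitions (?m - j)).
      boolean_cumulant \<phi> (take j Xs) * ?w (drop j Xs) \<pi>)"
    by (rule sum.cong) (auto simp: split)
  also have "\<dots> = (\<Sum>j=1..?m. \<Sum>\<pi>\<in>interval_partitions (?m - j).
      boolean_cumulant \<phi> (take j Xs) * ?w (drop j Xs) \<pi>)"
    by (rule sum.Sigma[symmetric]) (auto simp: finite_interval_partitions)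
  finally show ?thesis by (simp add: moment sum_distrib_left)
qed


section \<open>Operators on a complex Hilbert space\<close>

text \<open>Evaluate at the minimiser \<open>t = - b / c\<close>. For \<open>c = 0\<close> the
  expression is affine in \<open>t\<close> and stays nonnegative only if \<open>b = 0\<close>. This
  serves both Cauchy-Schwarz and the log-convexity of moments.\<close>

lemma discriminant_le_if_quadratic_nonneg:
  fixes a b c :: real
  assumes "\<And>t. 0 \<le> a + 2 * t * b + t\<^sup>2 * c" "0 \<le> c"
  shows "b\<^sup>2 \<le> a * c"
proof (cases "c = 0")
  case True
  have "b = 0"
  proof (rule ccontr)
    assume "b \<noteq> 0"
    then have "a + 2 * (- (a + 1) / (2 * b)) * b = -1" by (simp add: field_simps)
    then show False using assms(1)[of "- (a + 1) / (2 * b)"] True by simp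
  qed
  then show ?thesis using True by simp
next
  case False
  then have "c > 0" using assms(2) by simp
  have "a + 2 * (- b / c) * b + (- b / c)\<^sup>2 * c = a - b\<^sup>2 / c"
    using \<open>c > 0\<close> by (simp add: power2_eq_square field_simps)
  then have "b\<^sup>2 / c \<le> a" using assms(1)[of "- b / c"] by simp
  then show ?thesis using \<open>c > 0\<close> by (simp add: divide_le_eq)
qed

lemma cinner_add_right: "cinner x (y + z) = cinner x y + cinner x (z :: 'a::complex_hilbert_space)"
  by (metis cinner_commute cinner_add_left complex_cnj_add)

lemma cinner_scaleC_right: "cinner x (c *\<^sub>C y) = cnj c * cinner x (y :: 'a::complex_hilbert_space)"
  by (metis cinner_commute cinner_scaleC_left complex_cnj_mult)

lemma cinner_minus_left: "cinner (- x) y = - cinner x (y :: 'a::complex_hilbert_space)"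
  using cinner_scaleC_left[of "-1" x y] scaleC_of_real[of "-1" x] by simp

lemma cinner_minus_right: "cinner x (- y) = - cinner x (y :: 'a::complex_hilbert_space)"
  by (metis cinner_commute cinner_minus_left complex_cnj_minus)

lemma cinner_scaleR_left: "cinner (r *\<^sub>R x) y = of_real r * cinner x (y :: 'a::complex_hilbert_space)"
  by (metis cinner_scaleC_left scaleC_of_real)

lemma cinner_scaleR_right: "cinner x (r *\<^sub>R y) = of_real r * cinner x (y :: 'a::complex_hilbert_space)"
  by (metis cinner_scaleC_right scaleC_of_real complex_cnj_complex_of_real)

text \<open>The quadratic form of a self-adjoint operator is real, so positivity can be tested with
  the real inner product.\<close>

lemma positive_op_iff: "positive_op A \<longleftrightarrow> self_adjoint A \<and> (\<forall>x. 0 \<le> A x \<bullet> x)"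
proof -
  have "Im (cinner (A x) x) = 0" if "self_adjoint A" for x
  proof -
    have "cinner (A x) x = cnj (cinner (A x) x)"
      using that cinner_commute[of x "A x"] by (simp add: self_adjoint_def is_adjoint_def)
    then show ?thesis by (metis complex_cnj_cancel_iff complex_cnj_complex_of_real Reals_cnj_iff complex_is_Real_iff)
  qed
  then show ?thesis
    by (auto simp: positive_op_def inner_eq_Re_cinner complex_nonneg_Reals_iff)
qed

lemma self_adjoint_inner: "self_adjoint A \<Longrightarrow> A x \<bullet> y = x \<bullet> A y"
  by (simp add: self_adjoint_def is_adjoint_def inner_eq_Re_cinner)

lemma self_adjoint_id: "self_adjoint id_blinfun"
  by (simp add: self_adjoint_def is_adjoint_def)

lemma self_adjoint_add: "self_adjoint A \<Longrightarrow> self_adjoint B \<Longrightarrow> self_adjoint (A + B)"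
  by (simp add: self_adjoint_def is_adjoint_def blinfun.add_left cinner_add_left cinner_add_right)

lemma self_adjoint_scaleR: "self_adjoint A \<Longrightarrow> self_adjoint (r *\<^sub>R A)"
  by (simp add: self_adjoint_def is_adjoint_def blinfun.scaleR_left cinner_scaleR_left
      cinner_scaleR_right)

lemma positive_op_conjugate:
  assumes "positive_op P" "self_adjoint X"
  shows "positive_op (X o\<^sub>L P o\<^sub>L X)"
  unfolding positive_op_iff
proof (intro conjI allI)
  show "self_adjoint (X o\<^sub>L P o\<^sub>L X)"
    using assms by (simp add: positive_op_def self_adjoint_def is_adjoint_def)
  show "0 \<le> (X o\<^sub>L P o\<^sub>L X) x \<bullet> x" for x
    using assms(1) self_adjoint_inner[OF assms(2), of "P (X x)" x] by (simp add: positive_op_iff)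
qed

lemma positive_op_Cauchy_Schwarz:
  assumes "positive_op A"
  shows "(A x \<bullet> y)\<^sup>2 \<le> (A x \<bullet> x) * (A y \<bullet> y)"
proof (rule discriminant_le_if_quadratic_nonneg)
  fix t
  have "A y \<bullet> x = A x \<bullet> y"
    using assms self_adjoint_inner[of A y x] by (simp add: positive_op_def inner_commute)
  then have "A (x + t *\<^sub>R y) \<bullet> (x + t *\<^sub>R y) = A x \<bullet> x + 2 * t * (A x \<bullet> y) + t\<^sup>2 * (A y \<bullet> y)"
    by (simp add: blinfun.add_right blinfun.scaleR_right inner_add_left inner_add_right
        power2_eq_square algebra_simps)
  then show "0 \<le> A x \<bullet> x + 2 * t * (A x \<bullet> y) + t\<^sup>2 * (A y \<bullet> y)"
    using assms unfolding positive_op_iff by metis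
next
  show "0 \<le> A y \<bullet> y" using assms by (simp add: positive_op_iff)
qed

text \<open>Cauchy-Schwarz for the form of \<open>A\<close>, taken at \<open>y = A x\<close>, bounds
  the fourth power of \<open>norm (A x)\<close>; a factor \<open>(norm (A x))\<^sup>2\<close> then
  cancels.\<close>

lemma positive_op_norm_sq_le:
  assumes "positive_op A" "\<And>y. A y \<bullet> y \<le> r * (norm y)\<^sup>2"
  shows "(norm (A x))\<^sup>2 \<le> r * (A x \<bullet> x)"
proof (cases "A x = 0")
  case False
  have pos: "0 \<le> A x \<bullet> x" using assms(1) by (simp add: positive_op_iff)
  have "((norm (A x))\<^sup>2)\<^sup>2 \<le> (A x \<bullet> x) * (A (A x) \<bullet> A x)"
    using positive_op_Cauchy_Schwarz[OF assms(1), of x "A x"] by (simp add: power2_norm_eq_inner)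
  also have "\<dots> \<le> (A x \<bullet> x) * (r * (norm (A x))\<^sup>2)"
    by (rule mult_left_mono[OF assms(2) pos])
  finally have "(norm (A x))\<^sup>2 * (norm (A x))\<^sup>2 \<le> r * (A x \<bullet> x) * (norm (A x))\<^sup>2"
    by (simp add: power2_eq_square algebra_simps)
  then show ?thesis
    by (rule mult_right_le_imp_le) (use False in simp)
qed (use assms(1) in simp)

lemma inner_blinfun_le: "A x \<bullet> x \<le> norm A * (norm x)\<^sup>2"
  for A :: "'a::real_inner \<Rightarrow>\<^sub>L 'a"
proof -
  have "A x \<bullet> x \<le> norm (A x) * norm x" by (rule norm_cauchy_schwarz)
  also have "\<dots> \<le> norm A * norm x * norm x" by (rule mult_right_mono[OF norm_blinfun]) simp
  finally show ?thesis by (simp add: power2_eq_square mult.assoc)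
qed

lemma positive_op_norm_le:
  assumes "positive_op A" "\<And>y. A y \<bullet> y \<le> r * (norm y)\<^sup>2" "0 \<le> r"
  shows "norm A \<le> r"
proof (rule norm_blinfun_bound[OF assms(3)])
  fix x
  have "(norm (A x))\<^sup>2 \<le> r * (A x \<bullet> x)" by (rule positive_op_norm_sq_le[OF assms(1,2)])
  also have "\<dots> \<le> r * (r * (norm x)\<^sup>2)" by (rule mult_left_mono[OF assms(2,3)])
  finally have "(norm (A x))\<^sup>2 \<le> (r * norm x)\<^sup>2" by (simp add: power2_eq_square algebra_simps)
  then show "norm (A x) \<le> r * norm x" using assms(3) by (simp add: power2_le_iff_abs_le)
qed

text \<open>Invertibility of \<open>P = 1 - U\<close> bounds \<open>\<parallel>P x\<parallel>\<close> from below; Cauchy-Schwarz for the form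
  \<open>\<langle>P x, y\<rangle>\<close> turns this into a spectral gap \<open>P \<ge> \<delta>\<close>.\<close>

lemma op_less_id_imp_norm_less_1:
  assumes "op_le 0 U" "op_less U id_blinfun"
  obtains r where "0 < r" "r < 1" "norm U \<le> r"
proof -
  let ?P = "id_blinfun - U"
  obtain C where C: "C o\<^sub>L ?P = id_blinfun" and P: "positive_op ?P"
    using assms(2) by (auto simp: op_less_def op_le_def)
  have U: "positive_op U" using assms(1) by (simp add: op_le_def)
  \<comment> \<open>The summand 1 gives \<open>k \<ge> 1\<close>, so that \<open>1 - 1 / k\<close>
    below is defined and lies in \<open>[0, 1)\<close>.\<close>
  define k where "k = (norm C)\<^sup>2 * norm ?P + 1"
  have k: "k \<ge> 1" by (simp add: k_def)
  have gap: "(norm x)\<^sup>2 \<le> k * (?P x \<bullet> x)" for x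
  proof -
    have "norm x = norm (C (?P x))"
      using C by (metis blinfun_apply_blinfun_compose blinfun_apply_id_blinfun id_apply)
    then have "norm x \<le> norm C * norm (?P x)" using norm_blinfun[of C "?P x"] by simp
    then have "(norm x)\<^sup>2 \<le> (norm C)\<^sup>2 * (norm (?P x))\<^sup>2"
      by (metis power_mono norm_ge_zero power_mult_distrib)
    also have "\<dots> \<le> (norm C)\<^sup>2 * (norm ?P * (?P x \<bullet> x))"
      by (intro mult_left_mono positive_op_norm_sq_le[OF P] inner_blinfun_le) simp
    also have "\<dots> \<le> k * (?P x \<bullet> x)"
      using P by (simp add: k_def positive_op_iff algebra_simps)
    finally show ?thesis .
  qed
  \<comment> \<open>The maximum with \<open>1/2\<close> keeps \<open>r\<close> strictly positive, as
    the geometric estimates require.\<close>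
  define r where "r = max (1 - 1 / k) (1/2)"
  have "U x \<bullet> x \<le> r * (norm x)\<^sup>2" for x
  proof -
    have "(norm x)\<^sup>2 \<le> k * ((norm x)\<^sup>2 - U x \<bullet> x)"
      using gap[of x] by (simp add: blinfun.diff_left inner_diff_left power2_norm_eq_inner)
    then have "U x \<bullet> x \<le> (1 - 1 / k) * (norm x)\<^sup>2"
      using k by (simp add: field_simps)
    also have "\<dots> \<le> r * (norm x)\<^sup>2"
      by (rule mult_right_mono) (auto simp: r_def)
    finally show ?thesis .
  qed
  moreover have "0 < r" "r < 1" using k by (auto simp: r_def)
  ultimately show ?thesis
    using positive_op_norm_le[OF U, of r] that[of r] by simp
qed

section \<open>Adjoints, complex scalars and commutants\<close>

lemma is_adjoint_sym: "is_adjoint A B \<Longrightarrow> is_adjoint B A"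
  unfolding is_adjoint_def by (metis cinner_commute)

text \<open>The square of \<open>norm (B y)\<close> equals \<open>A (B y) \<bullet> y\<close>; after
  Cauchy-Schwarz one factor \<open>norm (B y)\<close> cancels.\<close>

lemma is_adjoint_norm_le:
  assumes "is_adjoint A B"
  shows "norm B \<le> norm A"
proof (rule norm_blinfun_bound)
  fix y
  have "norm (B y) * norm (B y) = A (B y) \<bullet> y"
    using assms by (simp add: is_adjoint_def inner_eq_Re_cinner norm_eq_sqrt_inner
        flip: power2_eq_square) (simp add: flip: inner_eq_Re_cinner)
  also have "\<dots> \<le> norm A * norm (B y) * norm y"
    by (meson norm_cauchy_schwarz mult_right_mono norm_blinfun norm_ge_zero order_trans)
  finally show "norm (B y) \<le> norm A * norm y"
    by (cases "B y = 0") (simp_all add: mult.commute mult.left_commute)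
qed simp

lemma scaleC_op_of_real: "scaleC_op (of_real r) A = r *\<^sub>R A"
  by (rule blinfun_eqI) (simp add: scaleC_of_real blinfun.scaleR_left)

lemma norm_scaleC_op_le: "norm (scaleC_op c A) \<le> cmod c * norm A"
  by (rule norm_blinfun_bound) (simp_all add: norm_scaleC mult.assoc mult_left_mono norm_blinfun)

lemma commutant_id: "id_blinfun \<in> commutant S"
  by (auto simp: commutant_def complex_operators_def intro: blinfun_eqI)

lemma commutant_add: "A \<in> commutant S \<Longrightarrow> B \<in> commutant S \<Longrightarrow> A + B \<in> commutant S"
  by (auto simp: commutant_def complex_operators_def blinfun.add_left scaleC_add_right
      bounded_bilinear.add_left[OF bounded_bilinear_blinfun_compose]
      bounded_bilinear.add_right[OF bounded_bilinear_blinfun_compose])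

lemma blinfun_compose_assoc: "(A o\<^sub>L B) o\<^sub>L C = A o\<^sub>L (B o\<^sub>L C)"
  by (rule blinfun_eqI) simp

lemma commutant_compose: "A \<in> commutant S \<Longrightarrow> B \<in> commutant S \<Longrightarrow> A o\<^sub>L B \<in> commutant S"
  by (auto simp: commutant_def complex_operators_def blinfun_compose_assoc)
    (metis blinfun_compose_assoc)

text \<open>A complex scalar passes through the elements of \<open>S\<close> because they are
  complex-linear; the ambient type guarantees only real linearity.\<close>

lemma commutant_scaleC:
  assumes "A \<in> commutant S" "S \<subseteq> complex_operators"
  shows "scaleC_op c A \<in> commutant S"
proof -
  have "scaleC_op c A o\<^sub>L B = B o\<^sub>L scaleC_op c A" if "B \<in> S" for B
  proof (rule blinfun_eqI)
    fix x
    have "A (B x) = B (A x)"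
      using assms(1) that by (metis (mono_tags, lifting) commutant_def mem_Collect_eq
          blinfun_apply_blinfun_compose)
    moreover have "B (c *\<^sub>C A x) = c *\<^sub>C B (A x)"
      using assms(2) that by (auto simp: complex_operators_def)
    ultimately show "(scaleC_op c A o\<^sub>L B) x = (B o\<^sub>L scaleC_op c A) x" by simp
  qed
  moreover have "scaleC_op c A \<in> complex_operators"
    using assms(1) by (auto simp: commutant_def complex_operators_def scaleC_scaleC mult.commute)
  ultimately show ?thesis by (simp add: commutant_def)
qed

text \<open>The commutant is cut out by equations between norm-continuous functions of
  \<open>A\<close>. Closedness keeps limits of power series in \<open>U\<close> inside it.\<close>

lemma closed_commutant: "closed (commutant (S :: ('a::complex_hilbert_space \<Rightarrow>\<^sub>L 'a) set))"
proof -
  have "commutant S = {A :: 'a \<Rightarrow>\<^sub>L 'a. (\<forall>c x. blinfun_apply A (c *\<^sub>C x) = c *\<^sub>C blinfun_apply A x) \<and> (\<forall>B. B \<in> S \<longrightarrow> A o\<^sub>L B = B o\<^sub>L A)}"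
    by (auto simp: commutant_def complex_operators_def)
  moreover have "continuous_on UNIV (\<lambda>A. c *\<^sub>C blinfun_apply A x)" for c and x :: 'a
    by (intro bounded_linear.continuous_on[OF bounded_linear_scaleC] continuous_intros)
  ultimately show ?thesis
    by (auto intro!: closed_Collect_conj closed_Collect_all closed_Collect_imp open_Collect_const closed_Collect_eq
        continuous_intros bounded_bilinear.continuous_on[OF bounded_bilinear_blinfun_compose])
qed

section \<open>Powers of an operator\<close>

lemma op_power_0 [simp]: "op_power U 0 = id_blinfun"
  by (simp add: op_power_def)

lemma op_power_Suc [simp]: "op_power U (Suc n) = U o\<^sub>L op_power U n"
  by (simp add: op_power_def)

lemma blinfun_compose_id [simp]: "id_blinfun o\<^sub>L A = A" "A o\<^sub>L id_blinfun = A"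
  by (auto intro: blinfun_eqI)

lemma op_power_commute: "op_power U n o\<^sub>L U = U o\<^sub>L op_power U n"
  by (induction n) (simp_all add: blinfun_compose_assoc)

lemma norm_op_power_le:
  assumes "norm U \<le> r"
  shows "norm (op_power U n) \<le> r ^ n"
proof (induction n)
  case (Suc n)
  have "norm (U o\<^sub>L op_power U n) \<le> norm U * norm (op_power U n)"
    by (rule norm_blinfun_compose)
  also have "\<dots> \<le> r * r ^ n"
    using assms Suc by (intro mult_mono) (auto intro: order_trans[OF norm_ge_zero])
  finally show ?case by simp
qed (simp add: norm_blinfun_id_le)

lemma op_power_in_commutant: "U \<in> commutant S \<Longrightarrow> op_power U n \<in> commutant S"
  by (induction n) (simp_all add: commutant_id commutant_compose)

text \<open>Induction in steps of two: the power \<open>n + 2\<close> is the power \<open>n\<close>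
  conjugated by the self-adjoint \<open>U\<close>.\<close>

lemma positive_op_power:
  assumes "positive_op U"
  shows "positive_op (op_power U n)"
proof (induction n rule: induct_nat_012)
  case 0
  show ?case by (simp add: positive_op_iff self_adjoint_id)
next
  case (ge2 n)
  have "op_power U (Suc (Suc n)) = U o\<^sub>L op_power U n o\<^sub>L U"
    by (simp add: blinfun_compose_assoc op_power_commute)
  then show ?case
    using positive_op_conjugate[OF ge2(1)] assms by (simp add: positive_op_def)
qed (use assms in simp)

lemma op_prod_list_replicate: "op_prod_list (replicate l U) = op_power U l"
  by (induction l) (simp_all add: op_prod_list_def)

lemma op_prod_list_Cons_replicate:
  "op_prod_list (A # replicate l U) = A o\<^sub>L op_power U l"
  "op_prod_list (A # replicate l U @ [B]) = A o\<^sub>L (op_power U l o\<^sub>L B)"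
  "op_prod_list (replicate l U @ [B]) = op_power U l o\<^sub>L B"
proof -
  show *: "op_prod_list (replicate l U @ [B]) = op_power U l o\<^sub>L B"
    by (induction l) (simp_all add: op_prod_list_def blinfun_compose_assoc)
  show "op_prod_list (A # replicate l U) = A o\<^sub>L op_power U l"
    using op_prod_list_replicate[of l U] by (simp add: op_prod_list_def)
  show "op_prod_list (A # replicate l U @ [B]) = A o\<^sub>L (op_power U l o\<^sub>L B)"
    using * by (simp add: op_prod_list_def)
qed

section \<open>Power series at an operator\<close>

lemma zero_deriv_funpow: "(zero_deriv ^^ k) F = fps_shift k F"
  by (induction k) (auto simp: zero_deriv_def intro: fps_ext)


text \<open>Two rates compete: \<open>r\<close> bounds \<open>norm U\<close>, and
  \<open>\<rho>\<close> bounds the growth of coefficients. A function analytic only on the open unit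
  disc may require \<open>\<rho> > 1\<close>; the condition \<open>\<rho> * r < 1\<close> still
  makes its series converge at \<open>U\<close>.\<close>

locale geometric_series =
  fixes U :: "'h::complex_hilbert_space \<Rightarrow>\<^sub>L 'h" and r \<rho> :: real
  assumes norm_U_le: "norm U \<le> r" and r_pos: "0 < r" and \<rho>_pos: "0 < \<rho>" and r\<rho>_less_1: "\<rho> * r < 1"
begin

definition dominated :: "complex fps \<Rightarrow> real \<Rightarrow> bool" where
  "dominated F C \<longleftrightarrow> (\<forall>i. cmod (fps_nth F i) \<le> C * \<rho> ^ i)"

lemma dominated_nonneg: "dominated F C \<Longrightarrow> 0 \<le> C"
  unfolding dominated_def using norm_ge_zero[of "fps_nth F 0"] by (metis mult.right_neutral order_trans power_0)

lemma norm_term_le: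
  assumes "dominated F C"
  shows "norm (scaleC_op (fps_nth F i) (op_power U i)) \<le> C * (\<rho> * r) ^ i"
proof -
  have "norm (scaleC_op (fps_nth F i) (op_power U i)) \<le> cmod (fps_nth F i) * norm (op_power U i)"
    by (rule norm_scaleC_op_le)
  also have "\<dots> \<le> (C * \<rho> ^ i) * r ^ i"
    using assms norm_op_power_le[OF norm_U_le, of i] dominated_nonneg[OF assms] \<rho>_pos
    by (intro mult_mono) (auto simp: dominated_def)
  finally show ?thesis by (simp add: power_mult_distrib mult.assoc)
qed

lemma summable_bound: "summable (\<lambda>i. C * (\<rho> * r) ^ i)"
  using r_pos \<rho>_pos r\<rho>_less_1 by (intro summable_mult summable_geometric) simp

lemma summable_terms:
  assumes "dominated F C"
  shows "summable (\<lambda>i. scaleC_op (fps_nth F i) (op_power U i))"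
  by (rule summable_comparison_test'[OF summable_bound]) (rule norm_term_le[OF assms])

lemma norm_fps_op_le:
  assumes "dominated F C"
  shows "norm (fps_op F U) \<le> C / (1 - \<rho> * r)"
proof -
  have "norm (fps_op F U) \<le> (\<Sum>i. C * (\<rho> * r) ^ i)"
    unfolding fps_op_def by (rule norm_suminf_le[OF norm_term_le[OF assms] summable_bound])
  also have "\<dots> = C * (\<Sum>i. (\<rho> * r) ^ i)"
    using r_pos \<rho>_pos r\<rho>_less_1 by (intro suminf_mult summable_geometric) simp
  also have "\<dots> = C / (1 - \<rho> * r)"
    using r_pos \<rho>_pos r\<rho>_less_1 by (subst suminf_geometric) simp_all
  finally show ?thesis .
qed

text \<open>The partial sums lie in the commutant, which is closed. Taking the commutant of the
  algebra as \<open>S\<close> puts the operator into the algebra; taking \<open>{U}\<close> shows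
  that it commutes with \<open>U\<close>.\<close>

lemma fps_op_in_commutant:
  assumes "dominated F C" "U \<in> commutant S" "S \<subseteq> complex_operators"
  shows "fps_op F U \<in> commutant S"
proof -
  have "(\<Sum>i<n. scaleC_op (fps_nth F i) (op_power U i)) \<in> commutant S" for n
  proof (induction n)
    case 0
    show ?case
      using commutant_scaleC[OF commutant_id assms(3), of 0] scaleC_op_of_real[of 0 "id_blinfun :: 'h \<Rightarrow>\<^sub>L 'h"]
      by (metis lessThan_0 of_real_0 scaleR_zero_left sum.empty)
  qed (use assms in \<open>simp add: commutant_add commutant_scaleC op_power_in_commutant\<close>)
  then show ?thesis
    unfolding fps_op_def
    using closed_sequentially[OF closed_commutant _ summable_LIMSEQ[OF summable_terms[OF assms(1)]]]
    by blast
qed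

text \<open>Each shift costs a factor \<open>\<rho>\<close> in the constant. For
  \<open>\<rho> > 1\<close> this growth has to be absorbed by the powers of \<open>r\<close> in the
  remainder.\<close>

lemma dominated_zero_deriv: "dominated F C \<Longrightarrow> dominated ((zero_deriv ^^ k) F) (C * \<rho> ^ k)"
  by (auto simp: dominated_def zero_deriv_funpow mult.assoc add.commute simp flip: power_add)

lemma fps_op_split:
  assumes "dominated F C" "U \<in> complex_operators"
  shows "fps_op F U = scaleC_op (fps_nth F 0) id_blinfun + (U o\<^sub>L fps_op (zero_deriv F) U)"
proof -
  have "U o\<^sub>L scaleC_op c A = scaleC_op c (U o\<^sub>L A)" for c A
    using assms(2) by (intro blinfun_eqI) (simp add: complex_operators_def)
  moreover have "summable (\<lambda>i. scaleC_op (fps_nth (zero_deriv F) i) (op_power U i))"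
    using summable_terms[OF dominated_zero_deriv[OF assms(1), of 1]] by simp
  ultimately have "U o\<^sub>L fps_op (zero_deriv F) U =
      (\<Sum>i. scaleC_op (fps_nth F (Suc i)) (op_power U (Suc i)))"
    unfolding fps_op_def
    by (simp add: bounded_linear.suminf[OF bounded_bilinear.bounded_linear_right[OF bounded_bilinear_blinfun_compose]]
        zero_deriv_def)
  then show ?thesis
    using suminf_split_head[OF summable_terms[OF assms(1)]] by (simp add: fps_op_def)
qed

end

section \<open>Moments of a tracial state\<close>

locale tracial_state =
  fixes \<A> :: "('h::complex_hilbert_space \<Rightarrow>\<^sub>L 'h) set" and \<phi> :: "('h \<Rightarrow>\<^sub>L 'h) \<Rightarrow> complex"
  assumes W: "W_star_probability_space \<A> \<phi>"
begin

lemma von_neumann: "von_neumann_algebra \<A>"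
  using W by (simp add: W_star_probability_space_def finite_von_neumann_algebra_def)

text \<open>Viewing the algebra as a commutant makes its closure properties instances of those
  proved for commutants.\<close>

lemma bicommutant: "commutant (commutant \<A>) = \<A>"
  using von_neumann by (simp add: von_neumann_algebra_def)

lemma commutant_subset: "commutant \<A> \<subseteq> complex_operators"
  by (auto simp: commutant_def)

lemma id_in: "id_blinfun \<in> \<A>"
  using commutant_id[of "commutant \<A>"] by (simp add: bicommutant)

lemma add_in: "A \<in> \<A> \<Longrightarrow> B \<in> \<A> \<Longrightarrow> A + B \<in> \<A>"
  using commutant_add[of A "commutant \<A>" B] by (simp add: bicommutant)

lemma compose_in: "A \<in> \<A> \<Longrightarrow> B \<in> \<A> \<Longrightarrow> A o\<^sub>L B \<in> \<A>"
  using commutant_compose[of A "commutant \<A>" B] by (simp add: bicommutant)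

lemma scaleC_in: "A \<in> \<A> \<Longrightarrow> scaleC_op c A \<in> \<A>"
  using commutant_scaleC[OF _ commutant_subset, of A c] by (simp add: bicommutant)

lemma scaleR_in: "A \<in> \<A> \<Longrightarrow> r *\<^sub>R A \<in> \<A>"
  using scaleC_in[of A "of_real r"] by (simp add: scaleC_op_of_real)

lemma power_in: "A \<in> \<A> \<Longrightarrow> op_power A n \<in> \<A>"
  by (induction n) (auto simp: id_in compose_in)

lemma phi_add: "A \<in> \<A> \<Longrightarrow> B \<in> \<A> \<Longrightarrow> \<phi> (A + B) = \<phi> A + \<phi> B"
  and phi_scaleC: "A \<in> \<A> \<Longrightarrow> \<phi> (scaleC_op c A) = c * \<phi> A"
  and phi_positive: "A \<in> \<A> \<Longrightarrow> positive_op A \<Longrightarrow> \<phi> A \<in> \<real>\<^sub>\<ge>\<^sub>0"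
  and phi_id: "\<phi> id_blinfun = 1"
  using W by (auto simp: W_star_probability_space_def state_on_def)

lemma phi_scaleR: "A \<in> \<A> \<Longrightarrow> \<phi> (r *\<^sub>R A) = of_real r * \<phi> A"
  using phi_scaleC[of A "of_real r"] by (simp add: scaleC_op_of_real)

lemma phi_compose_commute: "A \<in> \<A> \<Longrightarrow> B \<in> \<A> \<Longrightarrow> \<phi> (A o\<^sub>L B) = \<phi> (B o\<^sub>L A)"
  using W by (auto simp: W_star_probability_space_def tracial_on_def)

lemma faithful: "A \<in> \<A> \<Longrightarrow> positive_op A \<Longrightarrow> \<phi> A = 0 \<Longrightarrow> A = 0"
  using W by (auto simp: W_star_probability_space_def faithful_on_def)

text \<open>Both \<open>norm A\<close> times the identity plus \<open>A\<close> and the same minus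
  \<open>A\<close> are positive. That their values are nonnegative reals gives reality and the bound
  together.\<close>

lemma phi_self_adjoint_le:
  assumes A: "A \<in> \<A>" "self_adjoint A"
  shows "Im (\<phi> A) = 0" "cmod (\<phi> A) \<le> norm A"
proof -
  have *: "norm A *\<^sub>R id_blinfun + s *\<^sub>R A \<in> \<A> \<and> positive_op (norm A *\<^sub>R id_blinfun + s *\<^sub>R A)"
    if "s = 1 \<or> s = -1" for s :: real
  proof
    show "positive_op (norm A *\<^sub>R id_blinfun + s *\<^sub>R A)"
      unfolding positive_op_iff
    proof (intro conjI allI)
      show "self_adjoint (norm A *\<^sub>R id_blinfun + s *\<^sub>R A)"
        by (intro self_adjoint_add self_adjoint_scaleR self_adjoint_id A)
      fix x
      show "0 \<le> (norm A *\<^sub>R id_blinfun + s *\<^sub>R A) x \<bullet> x"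
        using inner_blinfun_le[of A x] inner_blinfun_le[of "- A" x] that
        by (auto simp: blinfun.add_left blinfun.scaleR_left blinfun.minus_left inner_add_left power2_norm_eq_inner)
    qed
  qed (intro add_in scaleR_in id_in A)
  have "of_real (norm A) + of_real s * \<phi> A \<in> \<real>\<^sub>\<ge>\<^sub>0" if "s = 1 \<or> s = -1" for s :: real
    using phi_positive *[OF that] that A
    by (metis phi_add phi_scaleR phi_id scaleR_in id_in mult.right_neutral)
  from this[of 1] this[of "-1"] have "0 \<le> norm A + Re (\<phi> A)" "0 \<le> norm A - Re (\<phi> A)" and im: "Im (\<phi> A) = 0"
    by (simp_all add: complex_nonneg_Reals_iff)
  then have "\<bar>Re (\<phi> A)\<bar> \<le> norm A" by simp
  then show "Im (\<phi> A) = 0" "cmod (\<phi> A) \<le> norm A"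
    using im by (simp_all add: cmod_eq_Re)
qed

text \<open>Split \<open>A\<close> into its self-adjoint real and imaginary parts \<open>H\<close>
  and \<open>K\<close>, each of norm at most \<open>norm A\<close>. The factor 2 is harmless, since
  the bound only feeds a limit equal to 0.\<close>

lemma phi_le:
  assumes A: "A \<in> \<A>"
  shows "cmod (\<phi> A) \<le> 2 * norm A"
proof -
  obtain B where B: "B \<in> \<A>" "is_adjoint A B"
    using von_neumann A by (auto simp: von_neumann_algebra_def)
  define H where "H = (1/2) *\<^sub>R (A + B)"
  \<comment> \<open>Here \<open>- \<i> / 2\<close> is 1 over \<open>2 * \<i>\<close>. The difference
    is written as a sum with a scaled \<open>B\<close> so that \<open>add_in\<close> and
    \<open>scaleR_in\<close> give membership in the algebra.\<close>
  define K where "K = scaleC_op (- \<i> / 2) (A + (-1) *\<^sub>R B)"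
  have nB: "norm B \<le> norm A" by (rule is_adjoint_norm_le[OF B(2)])
  have adj: "cinner (A x) y = cinner x (B y)" "cinner (B x) y = cinner x (A y)" for x y
    using B(2) is_adjoint_sym[OF B(2)] by (simp_all add: is_adjoint_def)
  have "H \<in> \<A>" "K \<in> \<A>"
    unfolding H_def K_def by (intro scaleR_in scaleC_in add_in A B(1))+
  moreover have "self_adjoint H" "self_adjoint K"
    unfolding H_def K_def
    by (auto simp: self_adjoint_def is_adjoint_def blinfun.add_left blinfun.scaleR_left blinfun.minus_left
        blinfun.diff_left diff_conv_add_uminus
        cinner_add_left cinner_add_right cinner_scaleR_left cinner_scaleR_right cinner_scaleC_left
        cinner_scaleC_right cinner_minus_left cinner_minus_right adj algebra_simps
        simp del: add_uminus_conv_diff)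
  ultimately have H: "H \<in> \<A>" "self_adjoint H" and K: "K \<in> \<A>" "self_adjoint K" by auto
  have "norm H \<le> (norm A + norm B) / 2"
    unfolding H_def using norm_triangle_ineq[of A B] by simp
  moreover have "norm K \<le> (norm A + norm B) / 2"
    unfolding K_def using norm_scaleC_op_le[of "- \<i> / 2" "A + (-1) *\<^sub>R B"] norm_triangle_ineq4[of A B]
    by (simp add: norm_divide)
  moreover have "A = H + scaleC_op \<i> K"
  proof (rule blinfun_eqI)
    fix x
    have "\<i> *\<^sub>C (- \<i> / 2) *\<^sub>C z = (1/2) *\<^sub>R z" for z :: 'h
      using scaleC_of_real[of "1/2" z] by (simp add: scaleC_scaleC)
    then show "A x = (H + scaleC_op \<i> K) x"
      by (simp add: H_def K_def blinfun.add_left blinfun.scaleR_left blinfun.minus_left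
          blinfun.diff_left algebra_simps flip: scaleR_add_left)
  qed
  then have "cmod (\<phi> A) \<le> cmod (\<phi> H) + cmod (\<phi> K)"
    using H K by (simp add: phi_add phi_scaleC scaleC_in norm_triangle_le norm_mult)
  ultimately show ?thesis
    using phi_self_adjoint_le(2)[OF H] phi_self_adjoint_le(2)[OF K] nB
    by (simp add: field_simps)
qed

text \<open>For real \<open>t\<close>, conjugating the positive power \<open>n\<close> of
  \<open>U\<close> by \<open>U + t\<close> gives a positive operator. Its value under
  \<open>\<phi>\<close> is a quadratic in \<open>t\<close> with the three moments as coefficients,
  so the discriminant bound applies.\<close>

lemma moment_log_convex:
  assumes U: "U \<in> \<A>" "positive_op U"
  shows "(Re (\<phi> (op_power U (Suc n))))\<^sup>2 \<le> Re (\<phi> (op_power U (Suc (Suc n)))) * Re (\<phi> (op_power U n))"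
proof (rule discriminant_le_if_quadratic_nonneg)
  fix t :: real
  let ?X = "U + t *\<^sub>R id_blinfun"
  let ?P = "op_power U (Suc (Suc n)) + ((2 * t) *\<^sub>R op_power U (Suc n) + t\<^sup>2 *\<^sub>R op_power U n)"
  have "?X o\<^sub>L op_power U n o\<^sub>L ?X = ?P"
  proof (rule blinfun_eqI)
    fix x
    have "op_power U n (U x) = U (op_power U n x)"
      using op_power_commute[of U n] by (metis blinfun_apply_blinfun_compose)
    moreover have "(2 * t) *\<^sub>R z = t *\<^sub>R z + t *\<^sub>R z" for z :: 'h
      by (simp flip: scaleR_add_left)
    ultimately show "(?X o\<^sub>L op_power U n o\<^sub>L ?X) x = ?P x"
      by (simp only: blinfun_apply_blinfun_compose op_power_Suc blinfun.add_left blinfun.add_right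
          blinfun.scaleR_left blinfun.scaleR_right blinfun_apply_id_blinfun id_apply
          scaleR_add_right scaleR_scaleR power2_eq_square add.assoc)
  qed
  moreover have "positive_op (?X o\<^sub>L op_power U n o\<^sub>L ?X)"
    using U by (intro positive_op_conjugate positive_op_power self_adjoint_add self_adjoint_scaleR
        self_adjoint_id) (simp_all add: positive_op_def)
  moreover have "?P \<in> \<A>" by (intro add_in scaleR_in power_in U)
  ultimately have "\<phi> ?P \<in> \<real>\<^sub>\<ge>\<^sub>0" using phi_positive by metis
  moreover have "\<phi> ?P = \<phi> (op_power U (Suc (Suc n))) + (of_real (2 * t) * \<phi> (op_power U (Suc n)) +
      of_real (t\<^sup>2) * \<phi> (op_power U n))"
    by (simp only: phi_add phi_scaleR add_in scaleR_in power_in[OF U(1)])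
  ultimately show "0 \<le> Re (\<phi> (op_power U (Suc (Suc n)))) + 2 * t * Re (\<phi> (op_power U (Suc n))) +
      t\<^sup>2 * Re (\<phi> (op_power U n))"
    by (simp add: complex_nonneg_Reals_iff del: op_power_Suc of_real_power)
next
  show "0 \<le> Re (\<phi> (op_power U n))"
    using phi_positive[OF power_in[OF U(1)] positive_op_power[OF U(2)]]
    by (simp add: complex_nonneg_Reals_iff)
qed

end


section \<open>Recursions for the eta transforms\<close>

text \<open>Kaluza's argument: log-convexity of \<open>m\<close> makes the ratios \<open>m (n + 1) / m n\<close> increase, so that in
  \<open>m n * e (n + 1) = (\<Sum>j = 1..n. e j * (m (n + 1) * m (n - j) - m n * m (n + 1 - j)))\<close>
  no term is negative.\<close>

lemma log_convex_renewal_bounds: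
  fixes m e :: "nat \<Rightarrow> real"
  assumes m0: "m 0 = 1" and pos: "\<And>n. 0 < m n"
    and convex: "\<And>n. (m (Suc n))\<^sup>2 \<le> m (Suc (Suc n)) * m n"
    and renewal: "\<And>n. 1 \<le> n \<Longrightarrow> m n = (\<Sum>j=1..n. e j * m (n - j))"
    and n: "1 \<le> n"
  shows "0 \<le> e n" "e n \<le> m n"
proof -
  have "incseq (\<lambda>n. m (Suc n) / m n)"
    using convex by (intro incseq_SucI) (simp add: pos divide_le_eq le_divide_eq power2_eq_square)
  then have ratio: "m n * m (Suc k) \<le> m (Suc n) * m k" if "k \<le> n" for k n
    using that pos[of n] pos[of k] by (auto dest: incseqD simp: divide_le_eq le_divide_eq mult_ac)
  have nonneg: "0 \<le> e n" if "1 \<le> n" for n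
    using that
  proof (induction n rule: less_induct)
    case (less n)
    then obtain k where k: "n = Suc k" by (cases n) auto
    show ?case
    proof (cases "k = 0")
      case True
      then show ?thesis using renewal[of 1] pos[of 1] k by (simp add: m0)
    next
      case False
      have "m n = e n + (\<Sum>j=1..k. e j * m (n - j))"
        using renewal[of n] by (simp add: k m0)
      then have "m k * e n = m n * m k - (\<Sum>j=1..k. e j * (m k * m (n - j)))"
        by (simp add: algebra_simps sum_distrib_left)
      \<comment> \<open>Only the factor \<open>m k\<close> is expanded, by the renewal equation at
        \<open>k\<close>, so that both sums run over the same \<open>j\<close>.\<close>
      also have "m n * m k = (\<Sum>j=1..k. e j * (m n * m (k - j)))"
        using renewal[of k] False by (simp add: sum_distrib_left algebra_simps)
      also have "\<dots> - (\<Sum>j=1..k. e j * (m k * m (n - j))) =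
          (\<Sum>j=1..k. e j * (m n * m (k - j) - m k * m (n - j)))"
        by (simp add: sum_subtractf algebra_simps)
      also have "\<dots> \<ge> 0"
      proof (rule sum_nonneg)
        fix j assume j: "j \<in> {1..k}"
        then have "m k * m (n - j) \<le> m n * m (k - j)"
          using ratio[of "k - j" k] by (simp add: k Suc_diff_le)
        moreover have "0 \<le> e j" using less.IH[of j] j k by simp
        ultimately show "0 \<le> e j * (m n * m (k - j) - m k * m (n - j))" by simp
      qed
      finally show ?thesis using pos[of k] by (simp add: zero_le_mult_iff)
    qed
  qed
  show "0 \<le> e n" by (rule nonneg[OF n])
  \<comment> \<open>The upper bound: the summand \<open>j = n\<close> is one of several nonnegative
    summands adding up to \<open>m n\<close>.\<close>
  have "e n * m (n - n) \<le> (\<Sum>j=1..n. e j * m (n - j))"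
    by (rule member_le_sum) (use n nonneg pos in \<open>auto simp: less_imp_le\<close>)
  then show "e n \<le> m n" using renewal[OF n] by (simp add: m0)
qed

section \<open>Moment series, eta transforms and their one-step recursions\<close>

locale positive_element = tracial_state \<A> \<phi> + geometric_series U r \<rho>
  for \<A> :: "('h::complex_hilbert_space \<Rightarrow>\<^sub>L 'h) set" and \<phi> U r \<rho> +
  assumes U_in: "U \<in> \<A>" and U_positive: "positive_op U"
begin

definition S :: "complex fps" where
  "S = Abs_fps (\<lambda>n. \<phi> (op_power U n))"

definition moments :: "complex fps \<Rightarrow> complex fps" where
  "moments F = Abs_fps (\<lambda>l. \<phi> (fps_op F U o\<^sub>L op_power U l))"

definition moments2 :: "complex fps \<Rightarrow> complex fps \<Rightarrow> complex fps" where
  "moments2 F G = Abs_fps (\<lambda>l. \<phi> (fps_op F U o\<^sub>L (op_power U l o\<^sub>L fps_op G U)))"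

lemma S_eq: "S = 1 + moment_fps \<phi> U"
  by (rule fps_ext) (simp add: S_def moment_fps_def phi_id)

lemma S_nth_0: "S $ 0 = 1"
  by (simp add: S_def phi_id)

text \<open>As \<open>S\<close> has constant coefficient 1, the division in \<open>eta\<close> is by
  a unit. Multiplication by \<open>1 - eta \<phi> U\<close> can then replace division by
  \<open>S\<close>.\<close>

lemma one_minus_eta: "(1 - eta \<phi> U) * S = 1"
proof -
  have "S \<noteq> 0" using S_nth_0 by (metis fps_zero_nth zero_neq_one)
  have "eta \<phi> U * S = moment_fps \<phi> U"
    unfolding eta_def S_eq[symmetric] using S_nth_0
    by (simp add: fps_divide_unit mult.assoc inverse_mult_eq_1)
  then show ?thesis by (simp add: algebra_simps S_eq)
qed

lemma subset_complex_operators: "\<A> \<subseteq> complex_operators"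
  using von_neumann by (simp add: von_neumann_algebra_def)

lemma fps_op_in: "dominated F C \<Longrightarrow> fps_op F U \<in> \<A>"
  using fps_op_in_commutant[of F C "commutant \<A>"] U_in commutant_subset by (simp add: bicommutant)

lemma fps_op_commute:
  assumes "dominated F C"
  shows "fps_op F U o\<^sub>L U = U o\<^sub>L fps_op F U"
proof -
  have "U \<in> commutant {U}" "{U} \<subseteq> complex_operators"
    using U_in subset_complex_operators by (auto simp: commutant_def)
  then have "fps_op F U \<in> commutant {U}" using fps_op_in_commutant[OF assms] by blast
  then show ?thesis by (simp add: commutant_def)
qed

lemma eta1_moments: "moments F = eta1 \<phi> F U * S"
proof (rule fps_ext)
  fix l
  let ?X = "fps_op F U # replicate l U"
  have "\<phi> (op_prod_list ?X) =
      (\<Sum>j=1..Suc l. boolean_cumulant \<phi> (take j ?X) * \<phi> (op_prod_list (drop j ?X)))"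
    using boolean_moment_cumulant_first_block[of ?X \<phi>] phi_id by simp
  also have "\<dots> = (\<Sum>i=0..l. boolean_cumulant \<phi> (take (Suc i) ?X) * \<phi> (op_prod_list (drop (Suc i) ?X)))"
    unfolding One_nat_def by (rule sum.shift_bounds_cl_Suc_ivl)
  \<comment> \<open>The first block consists of \<open>f(U)\<close> and \<open>i\<close> copies of
    \<open>U\<close>; what remains is the power \<open>l - i\<close> of \<open>U\<close>.\<close>
  also have "\<dots> = (\<Sum>i=0..l. eta1 \<phi> F U $ i * S $ (l - i))"
    by (intro sum.cong) (simp_all add: eta1_def S_def op_prod_list_replicate min_def)
  finally show "moments F $ l = (eta1 \<phi> F U * S) $ l"
    by (simp add: moments_def op_prod_list_Cons_replicate fps_mult_nth)
qed

lemma eta2_moments: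
  assumes "dominated G C"
  shows "moments2 F G = eta2 \<phi> F G U + eta1 \<phi> F U * moments G"
proof (rule fps_ext)
  fix l
  let ?X = "fps_op F U # replicate l U @ [fps_op G U]"
  let ?t = "\<lambda>j. boolean_cumulant \<phi> (take j ?X) * \<phi> (op_prod_list (drop j ?X))"
  have "\<phi> (op_prod_list ?X) = sum ?t {1..Suc (Suc l)}"
    using boolean_moment_cumulant_first_block[of ?X \<phi>] phi_id by simp
  \<comment> \<open>The case where the first block is the whole word is split off; it yields the
    coefficient of \<open>eta2\<close>.\<close>
  also have "\<dots> = (\<Sum>i=0..l. ?t (Suc i)) + ?t (Suc (Suc l))"
    using sum.shift_bounds_cl_Suc_ivl[of ?t 0 l] by simp
  also have "?t (Suc (Suc l)) = eta2 \<phi> F G U $ l"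
    by (simp add: eta2_def op_prod_list_def phi_id)
  \<comment> \<open>Traciality moves the trailing \<open>g(U)\<close> to the front, which is the
    form used in \<open>moments G\<close>.\<close>
  also have "(\<Sum>i=0..l. ?t (Suc i)) = (\<Sum>i=0..l. eta1 \<phi> F U $ i * moments G $ (l - i))"
    using phi_compose_commute[OF power_in[OF U_in] fps_op_in[OF assms]]
    by (intro sum.cong) (simp_all add: eta1_def moments_def op_prod_list_Cons_replicate min_def)
  finally show "moments2 F G $ l = (eta2 \<phi> F G U + eta1 \<phi> F U * moments G) $ l"
    by (simp add: moments2_def op_prod_list_Cons_replicate fps_mult_nth)
qed

text \<open>The factor \<open>U\<close> split off from the series commutes with the rest, so it can
  be moved to the right and merged with \<open>B\<close>.\<close>

lemma fps_op_compose_split: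
  assumes F: "dominated F C" and B: "B \<in> \<A>"
  shows "\<phi> (fps_op F U o\<^sub>L B) = fps_nth F 0 * \<phi> B + \<phi> (fps_op (zero_deriv F) U o\<^sub>L (U o\<^sub>L B))"
proof -
  have D: "dominated (zero_deriv F) (C * \<rho>)" using dominated_zero_deriv[OF F, of 1] by simp
  have "fps_op F U = scaleC_op (fps_nth F 0) id_blinfun + (fps_op (zero_deriv F) U o\<^sub>L U)"
    using fps_op_split[OF F] fps_op_commute[OF D] U_in subset_complex_operators by auto
  then have "fps_op F U o\<^sub>L B = scaleC_op (fps_nth F 0) B + (fps_op (zero_deriv F) U o\<^sub>L (U o\<^sub>L B))"
    by (auto intro!: blinfun_eqI simp: blinfun.add_left)
  then show ?thesis
    using B U_in fps_op_in[OF D] by (simp add: phi_add phi_scaleC scaleC_in compose_in)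
qed

text \<open>The subtracted constant is the zeroth coefficient of
  \<open>moments (zero_deriv F)\<close>, which has no counterpart on the left since
  \<open>fps_X\<close> kills degree 0.\<close>

lemma moments_split:
  assumes "dominated F C"
  shows "fps_X * moments F = fps_const (F $ 0) * (fps_X * S) + moments (zero_deriv F)
    - fps_const (\<phi> (fps_op (zero_deriv F) U))"
proof (rule fps_ext)
  fix n
  show "(fps_X * moments F) $ n = (fps_const (F $ 0) * (fps_X * S) + moments (zero_deriv F)
    - fps_const (\<phi> (fps_op (zero_deriv F) U))) $ n"
    using fps_op_compose_split[OF assms power_in[OF U_in]]
    by (cases n) (simp_all add: moments_def S_def)
qed

lemma moments2_split:
  assumes "dominated F C" "dominated G C'"
  shows "fps_X * moments2 F G = fps_const (F $ 0) * (fps_X * moments G) + moments2 (zero_deriv F) G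
    - fps_const (moments2 (zero_deriv F) G $ 0)"
proof (rule fps_ext)
  fix n
  show "(fps_X * moments2 F G) $ n = (fps_const (F $ 0) * (fps_X * moments G) + moments2 (zero_deriv F) G
    - fps_const (moments2 (zero_deriv F) G $ 0)) $ n"
    using fps_op_compose_split[OF assms(1) compose_in[OF power_in[OF U_in] fps_op_in[OF assms(2)]]]
      phi_compose_commute[OF power_in[OF U_in] fps_op_in[OF assms(2)]]
    by (cases n) (simp_all add: moments_def moments2_def blinfun_compose_assoc)
qed

lemma eta1_eq: "eta1 \<phi> F U = moments F * (1 - eta \<phi> U)"
proof -
  have "moments F * (1 - eta \<phi> U) = eta1 \<phi> F U * ((1 - eta \<phi> U) * S)"
    unfolding eta1_moments by (simp only: mult_ac)
  then show ?thesis by (simp add: one_minus_eta)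
qed

lemma eta1_split:
  assumes "dominated F C"
  shows "fps_X * eta1 \<phi> F U = fps_const (F $ 0) * fps_X + eta1 \<phi> (zero_deriv F) U
    - fps_const (\<phi> (fps_op (zero_deriv F) U)) * (1 - eta \<phi> U)"
proof -
  have "fps_X * eta1 \<phi> F U = (fps_X * moments F) * (1 - eta \<phi> U)"
    by (simp add: eta1_eq mult.assoc)
  also have "\<dots> = fps_const (F $ 0) * fps_X * ((1 - eta \<phi> U) * S) + moments (zero_deriv F) * (1 - eta \<phi> U)
    - fps_const (\<phi> (fps_op (zero_deriv F) U)) * (1 - eta \<phi> U)"
    unfolding moments_split[OF assms] by (simp only: ring_distribs mult_ac)
  finally show ?thesis by (simp add: one_minus_eta eta1_eq)
qed

text \<open>Compare coefficients of degree \<open>l + 1\<close> in \<open>eta1_split\<close>: the 1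
  in \<open>1 - eta \<phi> U\<close> is invisible there, and \<open>F $ 0\<close> survives only for
  \<open>l = 0\<close>.\<close>

lemma eta1_step:
  assumes "dominated F C"
  shows "eta1 \<phi> F U $ l = (if l = 0 then F $ 0 else 0)
    + \<phi> (fps_op (zero_deriv F) U) * eta \<phi> U $ Suc l + eta1 \<phi> (zero_deriv F) U $ Suc l"
  using arg_cong[OF eta1_split[OF assms], of "\<lambda>A. fps_nth A (Suc l)"]
  by auto

lemma eta2_step:
  assumes F: "dominated F C" and G: "dominated G C'"
  shows "eta2 \<phi> F G U $ l = \<phi> (fps_op (zero_deriv F) U) * eta1 \<phi> G U $ Suc l
    + eta2 \<phi> (zero_deriv F) G U $ Suc l"
proof -
  let ?c = "fps_const (\<phi> (fps_op (zero_deriv F) U))"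
  have "fps_X * eta2 \<phi> F G U = fps_X * moments2 F G - (fps_X * eta1 \<phi> F U) * moments G"
    by (simp add: eta2_moments[OF G] algebra_simps)
  \<comment> \<open>The summands with \<open>F $ 0\<close> cancel, so no constant is left over,
    unlike in the recursion for \<open>eta1\<close>.\<close>
  also have "\<dots> = (moments2 (zero_deriv F) G - eta1 \<phi> (zero_deriv F) U * moments G)
      - fps_const (moments2 (zero_deriv F) G $ 0) + ?c * (moments G * (1 - eta \<phi> U))"
    unfolding moments2_split[OF F G] eta1_split[OF F] by (simp add: algebra_simps)
  also have "\<dots> = eta2 \<phi> (zero_deriv F) G U - fps_const (moments2 (zero_deriv F) G $ 0)
      + ?c * eta1 \<phi> G U"
    by (simp add: eta2_moments[OF G] eta1_eq)
  finally have "fps_nth (fps_X * eta2 \<phi> F G U) (Suc l) = fps_nth (eta2 \<phi> (zero_deriv F) G U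
      - fps_const (moments2 (zero_deriv F) G $ 0) + ?c * eta1 \<phi> G U) (Suc l)"
    by simp
  then show ?thesis by simp
qed

lemma moment_nonneg: "0 \<le> Re (\<phi> (op_power U n))"
  and moment_real: "Im (\<phi> (op_power U n)) = 0"
  and norm_moment_le: "cmod (\<phi> (op_power U n)) \<le> r ^ n"
proof -
  have "positive_op (op_power U n)" by (rule positive_op_power[OF U_positive])
  then show "0 \<le> Re (\<phi> (op_power U n))" "Im (\<phi> (op_power U n)) = 0"
    using phi_positive[OF power_in[OF U_in]] by (simp_all add: complex_nonneg_Reals_iff)
  show "cmod (\<phi> (op_power U n)) \<le> r ^ n"
    using phi_self_adjoint_le(2)[OF power_in[OF U_in], of n] norm_op_power_le[OF norm_U_le, of n]
      \<open>positive_op (op_power U n)\<close> by (simp add: positive_op_def)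
qed

text \<open>Log-convexity carries a vanishing moment down to the first one, and faithfulness
  concludes. This supplies the strictly positive moments that Kaluza's argument uses.\<close>

lemma U_eq_0_if_moment_eq_0:
  assumes "\<phi> (op_power U n) = 0"
  shows "U = 0"
proof -
  have "\<phi> (op_power U (Suc 0)) = 0"
    using assms
  proof (induction n rule: induct_nat_012)
    case (ge2 n)
    have "Re (\<phi> (op_power U (Suc n))) = 0"
      using moment_log_convex[OF U_in U_positive, of n] ge2(3) by simp
    then show ?case using ge2(2) moment_real[of "Suc n"] by (simp add: complex_eq_iff)
  qed (simp_all add: phi_id)
  then show ?thesis using faithful[OF U_in U_positive] by simp
qed

lemma eta_nth_0: "eta \<phi> U $ 0 = 0"
  using arg_cong[OF one_minus_eta, of "\<lambda>A. fps_nth A 0"] by (simp add: S_nth_0)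

lemma renewal:
  assumes "1 \<le> n"
  shows "\<phi> (op_power U n) = (\<Sum>j=1..n. eta \<phi> U $ j * \<phi> (op_power U (n - j)))"
proof -
  have "eta \<phi> U * S = S - 1" using one_minus_eta by (simp add: algebra_simps)
  then have "(eta \<phi> U * S) $ n = (S - 1) $ n" by simp
  then show ?thesis
    using assms by (simp add: eta_nth_0 fps_mult_nth S_def sum.atLeast_Suc_atMost)
qed

text \<open>Kaluza's argument bounds the coefficients by the moments, hence by powers of
  \<open>r\<close>. It runs over strictly positive moments, so \<open>U = 0\<close>, where
  \<open>eta\<close> vanishes, is treated separately.\<close>

lemma norm_eta_le: "cmod (eta \<phi> U $ n) \<le> r ^ n"
proof (cases "U = 0")
  case True
  then have "moment_fps \<phi> U = 0"
    using phi_scaleC[OF id_in, of 0] scaleC_op_of_real[of 0 "id_blinfun :: 'h \<Rightarrow>\<^sub>L 'h"]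
    by (auto intro!: fps_ext simp: moment_fps_def gr0_conv_Suc)
  then show ?thesis using r_pos by (simp add: eta_def)
next
  case False
  define m where "m n = Re (\<phi> (op_power U n))" for n
  have phi_m: "\<phi> (op_power U n) = of_real (m n)" for n
    by (simp add: m_def complex_eq_iff moment_real)
  have m0: "m 0 = 1" by (simp add: m_def phi_id)
  have pos: "0 < m n" for n
  proof -
    have "m n \<noteq> 0" using U_eq_0_if_moment_eq_0[of n] False by (auto simp: phi_m)
    then show ?thesis using moment_nonneg[of n] by (simp add: m_def)
  qed
  have convex: "(m (Suc n))\<^sup>2 \<le> m (Suc (Suc n)) * m n" for n
    unfolding m_def by (rule moment_log_convex[OF U_in U_positive])
  have sum_m: "complex_of_real (m n) = (\<Sum>j=1..n. eta \<phi> U $ j * of_real (m (n - j)))" if "1 \<le> n" for n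
    using renewal[OF that] by (simp only: phi_m)
  have re: "m n = (\<Sum>j=1..n. Re (eta \<phi> U $ j) * m (n - j))" if "1 \<le> n" for n
    using arg_cong[OF sum_m[OF that], of Re] by simp
  have im: "(\<Sum>j=1..n. Im (eta \<phi> U $ j) * m (n - j)) = 0" if "1 \<le> n" for n
    using arg_cong[OF sum_m[OF that], of Im] by simp
  have real: "Im (eta \<phi> U $ n) = 0" if "1 \<le> n" for n
    using that
  proof (induction n rule: less_induct)
    case (less n)
    \<comment> \<open>By induction the earlier imaginary parts vanish, leaving only
      \<open>j = n\<close>, whose weight is \<open>m 0 = 1\<close>.\<close>
    then have "(\<Sum>j=1..n. Im (eta \<phi> U $ j) * m (n - j)) = (\<Sum>j\<in>{n}. Im (eta \<phi> U $ j) * m (n - j))"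
      by (intro sum.mono_neutral_right) auto
    then show ?case using im[OF less.prems] by (simp add: m0)
  qed
  show ?thesis
  proof (cases "n = 0")
    case True
    then show ?thesis by (simp add: eta_nth_0)
  next
    case False
    then have n: "1 \<le> n" by simp
    have "cmod (eta \<phi> U $ n) = Re (eta \<phi> U $ n)"
      using real[OF n] log_convex_renewal_bounds(1)[OF m0 pos convex re n] by (simp add: cmod_eq_Re)
    also have "\<dots> \<le> m n" by (rule log_convex_renewal_bounds(2)[OF m0 pos convex re n])
    also have "\<dots> \<le> r ^ n" using norm_moment_le[of n] pos[of n] by (simp add: phi_m)
    finally show ?thesis .
  qed
qed

end


section \<open>Norm bounds, vanishing remainders and summation of the recursions\<close>

lemma phi_D_term_psi_nth:
  "fps_nth (phi_D_term \<phi> U psi F H k) n =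
    (if k = 0 then 0 else \<phi> (fps_op ((zero_deriv ^^ k) F) U) * fps_nth H (n + k))"
  by (simp add: phi_D_term_def psi_def zero_deriv_funpow)

text \<open>With \<open>q = s\<^sup>2\<close> the sequence is the square of a linear factor times
  \<open>s ^ n\<close>, which tends to 0.\<close>

lemma tendsto_square_times_geometric:
  fixes q :: real
  assumes "0 < q" "q < 1"
  shows "(\<lambda>n. (real n + a)\<^sup>2 * q ^ n) \<longlonglongrightarrow> 0"
proof -
  define s where "s = sqrt q"
  have s: "0 < s" "s < 1" "s\<^sup>2 = q" using assms by (auto simp: s_def)
  have "(\<lambda>n. real n * s ^ n + a * s ^ n) \<longlonglongrightarrow> 0 + a * 0"
    using s by (intro tendsto_intros powser_times_n_limit_0 LIMSEQ_power_zero) auto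
  then have "(\<lambda>n. (real n * s ^ n + a * s ^ n)\<^sup>2) \<longlonglongrightarrow> 0\<^sup>2"
    by (intro tendsto_power) simp
  moreover have "(real n * s ^ n + a * s ^ n)\<^sup>2 = (real n + a)\<^sup>2 * q ^ n" for n
  proof -
    have "(s ^ n)\<^sup>2 = q ^ n" unfolding s(3)[symmetric] by (simp add: mult.commute flip: power_mult)
    then show ?thesis by (simp add: power_mult_distrib flip: distrib_right)
  qed
  ultimately show ?thesis by simp
qed

context positive_element
begin

lemma norm_moments_le:
  assumes "dominated F C"
  shows "cmod (fps_nth (moments F) l) \<le> 2 * norm (fps_op F U) * r ^ l"
proof -
  have "cmod (fps_nth (moments F) l) \<le> 2 * norm (fps_op F U o\<^sub>L op_power U l)"
    unfolding moments_def using phi_le[OF compose_in[OF fps_op_in[OF assms] power_in[OF U_in]]] by simp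
  also have "\<dots> \<le> 2 * (norm (fps_op F U) * norm (op_power U l))"
    by (intro mult_left_mono norm_blinfun_compose) simp
  also have "\<dots> \<le> 2 * (norm (fps_op F U) * r ^ l)"
    by (intro mult_left_mono norm_op_power_le norm_U_le) simp_all
  finally show ?thesis by simp
qed

lemma norm_moments2_le:
  assumes "dominated F C" "dominated G C'"
  shows "cmod (fps_nth (moments2 F G) l) \<le> 2 * norm (fps_op F U) * norm (fps_op G U) * r ^ l"
proof -
  have "cmod (fps_nth (moments2 F G) l) \<le> 2 * norm (fps_op F U o\<^sub>L (op_power U l o\<^sub>L fps_op G U))"
    unfolding moments2_def
    using phi_le[OF compose_in[OF fps_op_in[OF assms(1)] compose_in[OF power_in[OF U_in] fps_op_in[OF assms(2)]]]]
    by simp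
  also have "\<dots> \<le> 2 * (norm (fps_op F U) * norm (op_power U l o\<^sub>L fps_op G U))"
    by (intro mult_left_mono norm_blinfun_compose) simp
  also have "\<dots> \<le> 2 * (norm (fps_op F U) * (norm (op_power U l) * norm (fps_op G U)))"
    by (intro mult_left_mono norm_blinfun_compose) simp_all
  also have "\<dots> \<le> 2 * (norm (fps_op F U) * (r ^ l * norm (fps_op G U)))"
    by (intro mult_left_mono mult_right_mono norm_op_power_le norm_U_le) simp_all
  finally show ?thesis by (simp add: mult_ac)
qed

text \<open>In the product of \<open>moments F\<close> and \<open>1 - eta \<phi> U\<close> each of
  the \<open>l + 1\<close> convolution terms has the same bound, whence the linear factor.\<close>

lemma norm_eta1_le:
  assumes "dominated F C"
  shows "cmod (fps_nth (eta1 \<phi> F U) l) \<le> 2 * (real l + 1) * norm (fps_op F U) * r ^ l"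
proof -
  have le: "cmod (fps_nth (1 - eta \<phi> U) j) \<le> r ^ j" for j
    using norm_eta_le[of j] eta_nth_0 by (cases j) simp_all
  have "cmod (fps_nth (eta1 \<phi> F U) l) \<le>
      (\<Sum>i=0..l. cmod (fps_nth (moments F) i * fps_nth (1 - eta \<phi> U) (l - i)))"
    unfolding eta1_eq fps_mult_nth by (rule norm_sum)
  also have "\<dots> \<le> (\<Sum>i=0..l. 2 * norm (fps_op F U) * r ^ i * r ^ (l - i))"
    unfolding norm_mult using r_pos
    by (intro sum_mono mult_mono norm_moments_le[OF assms] le) auto
  also have "\<dots> = (\<Sum>i=0..l. 2 * norm (fps_op F U) * r ^ l)"
    by (intro sum.cong) (simp_all add: mult.assoc flip: power_add)
  finally show ?thesis by (simp add: algebra_simps)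
qed

text \<open>By \<open>eta2_moments\<close> this is \<open>moments2\<close> minus a convolution. The
  former contributes the factor 2, the latter \<open>4 * (real l + 1)\<^sup>2\<close>; together they
  stay below 6 times the square.\<close>

lemma norm_eta2_le:
  assumes F: "dominated F C" and G: "dominated G C'"
  shows "cmod (fps_nth (eta2 \<phi> F G U) l) \<le>
    6 * (real l + 1)\<^sup>2 * norm (fps_op F U) * norm (fps_op G U) * r ^ l"
proof -
  let ?f = "norm (fps_op F U)" and ?g = "norm (fps_op G U)"
  have "cmod (fps_nth (eta1 \<phi> F U * moments G) l) \<le>
      (\<Sum>i=0..l. cmod (fps_nth (eta1 \<phi> F U) i * fps_nth (moments G) (l - i)))"
    unfolding fps_mult_nth by (rule norm_sum)
  also have "\<dots> \<le> (\<Sum>i=0..l. (2 * (real i + 1) * ?f * r ^ i) * (2 * ?g * r ^ (l - i)))"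
    unfolding norm_mult using r_pos
    by (intro sum_mono mult_mono norm_moments_le[OF G] norm_eta1_le[OF F]) auto
  also have "\<dots> \<le> (\<Sum>i=0..l. (real l + 1) * (4 * ?f * ?g * r ^ l))"
  proof (rule sum_mono)
    fix i assume i: "i \<in> {0..l}"
    then have rl: "r ^ l = r ^ i * r ^ (l - i)" by (simp flip: power_add)
    have "(2 * (real i + 1) * ?f * r ^ i) * (2 * ?g * r ^ (l - i)) =
        (real i + 1) * (4 * ?f * ?g * r ^ l)"
      unfolding rl by (simp only: mult_ac)
    also have "\<dots> \<le> (real l + 1) * (4 * ?f * ?g * r ^ l)"
      using i r_pos by (intro mult_right_mono) auto
    finally show "(2 * (real i + 1) * ?f * r ^ i) * (2 * ?g * r ^ (l - i)) \<le>
        (real l + 1) * (4 * ?f * ?g * r ^ l)" .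
  qed
  also have "\<dots> = 4 * (real l + 1)\<^sup>2 * (?f * ?g * r ^ l)"
    by (simp add: power2_eq_square algebra_simps)
  finally have "cmod (fps_nth (eta2 \<phi> F G U) l) \<le>
      2 * (?f * ?g * r ^ l) + 4 * (real l + 1)\<^sup>2 * (?f * ?g * r ^ l)"
    using norm_moments2_le[OF F G, of l] norm_triangle_ineq4[of "fps_nth (moments2 F G) l" "fps_nth (eta1 \<phi> F U * moments G) l"]
    by (simp add: eta2_moments[OF G] mult_ac)
  also have "\<dots> = (2 + 4 * (real l + 1)\<^sup>2) * (?f * ?g * r ^ l)"
    by (simp add: algebra_simps)
  also have "\<dots> \<le> (6 * (real l + 1)\<^sup>2) * (?f * ?g * r ^ l)"
    using r_pos one_le_power[of "real l + 1" 2] by (intro mult_right_mono) auto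
  finally show ?thesis by (simp add: mult_ac)
qed

text \<open>The norm of the shifted series grows at most like \<open>\<rho> ^ k\<close>, so the
  bound is a constant times a quadratic in \<open>k\<close> times
  \<open>(\<rho> * r) ^ k\<close>.\<close>

lemma remainder_tendsto_0:
  assumes F: "dominated F C"
    and bound: "\<And>k. cmod (x k) \<le> B * (real (l + k) + 1)\<^sup>2 * norm (fps_op ((zero_deriv ^^ k) F) U) * r ^ (l + k)"
    and B: "0 \<le> B"
  shows "x \<longlonglongrightarrow> 0"
proof (rule Lim_null_comparison)
  let ?D = "B * (C / (1 - \<rho> * r)) * r ^ l"
  have "cmod (x k) \<le> ?D * ((real k + (real l + 1))\<^sup>2 * (\<rho> * r) ^ k)" for k
  proof -
    note bound[of k]
    also have "B * (real (l + k) + 1)\<^sup>2 * norm (fps_op ((zero_deriv ^^ k) F) U) * r ^ (l + k)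
        \<le> B * (real (l + k) + 1)\<^sup>2 * (C * \<rho> ^ k / (1 - \<rho> * r)) * r ^ (l + k)"
      using B r_pos
      by (intro mult_right_mono mult_left_mono norm_fps_op_le dominated_zero_deriv F) auto
    also have "\<dots> = ?D * ((real k + (real l + 1))\<^sup>2 * (\<rho> * r) ^ k)"
      by (simp add: power_add power_mult_distrib add_ac mult_ac)
    finally show ?thesis .
  qed
  then show "\<forall>\<^sub>F k in sequentially. norm (x k) \<le> ?D * ((real k + (real l + 1))\<^sup>2 * (\<rho> * r) ^ k)"
    by simp
  show "(\<lambda>k. ?D * ((real k + (real l + 1))\<^sup>2 * (\<rho> * r) ^ k)) \<longlonglongrightarrow> 0"
    using r_pos \<rho>_pos r\<rho>_less_1
    by (intro tendsto_mult_right_zero tendsto_square_times_geometric) auto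
qed

lemma eta1_sums:
  assumes F: "dominated F C"
  shows "(\<lambda>k. fps_nth (phi_D_term \<phi> U psi F (eta \<phi> U) k) l)
    sums (fps_nth (eta1 \<phi> F U) l - (if l = 0 then fps_nth F 0 else 0))"
proof -
  let ?t = "\<lambda>k. fps_nth (phi_D_term \<phi> U psi F (eta \<phi> U) k) l"
  let ?R = "\<lambda>k. fps_nth (eta1 \<phi> ((zero_deriv ^^ k) F) U) (l + k)"
  let ?s = "fps_nth (eta1 \<phi> F U) l - (if l = 0 then fps_nth F 0 else 0)"
  \<comment> \<open>The term \<open>k = 0\<close> vanishes because \<open>psi\<close> has no
    constant coefficient. Only the first recursion step, taken in degree \<open>l\<close>, can
    produce \<open>F $ 0\<close>; all later ones are in positive degree, so the telescoping starts
    after that step.\<close>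
  have partial: "sum ?t {..<Suc (Suc k)} = ?s - ?R (Suc k)" for k
  proof (induction k)
    case 0
    show ?case using eta1_step[OF F, of l] by (simp add: phi_D_term_psi_nth)
  next
    case (Suc k)
    have "?R (Suc k) = ?t (Suc (Suc k)) + ?R (Suc (Suc k))"
      using eta1_step[OF dominated_zero_deriv[OF F, of "Suc k"], of "l + Suc k"]
      by (simp add: phi_D_term_psi_nth)
    then show ?case using Suc by simp
  qed
  have "?R \<longlonglongrightarrow> 0"
  proof (rule remainder_tendsto_0[OF F, of _ 2])
    fix k
    let ?n = "norm (fps_op ((zero_deriv ^^ k) F) U) * r ^ (l + k)"
    have "cmod (?R k) \<le> (2 * (real (l + k) + 1)) * ?n"
      using norm_eta1_le[OF dominated_zero_deriv[OF F], of k "l + k"] by (simp add: mult.assoc)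
    \<comment> \<open>The linear factor is weakened to a square to fit the common remainder
      lemma.\<close>
    also have "\<dots> \<le> (2 * (real (l + k) + 1)\<^sup>2) * ?n"
      using r_pos self_le_power[of "real (l + k) + 1" 2] by (intro mult_right_mono) auto
    finally show "cmod (?R k) \<le> 2 * (real (l + k) + 1)\<^sup>2 * norm (fps_op ((zero_deriv ^^ k) F) U) * r ^ (l + k)"
      by (simp add: mult.assoc)
  qed simp
  then have "(\<lambda>k. ?s - ?R (Suc k)) \<longlonglongrightarrow> ?s - 0"
    by (intro tendsto_diff tendsto_const LIMSEQ_Suc)
  then have "(\<lambda>k. sum ?t {..<Suc (Suc k)}) \<longlonglongrightarrow> ?s" unfolding partial by simp
  then show ?thesis
    unfolding sums_def
    by (rule LIMSEQ_imp_Suc[of "\<lambda>n. sum ?t {..<n}", OF LIMSEQ_imp_Suc[of "\<lambda>n. sum ?t {..<Suc n}"]])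
qed

text \<open>The same telescoping, now with \<open>eta2_step\<close>; as no constant splits off, it
  starts at once and sums to the full coefficient.\<close>

lemma eta2_sums:
  assumes F: "dominated F C" and G: "dominated G C'"
  shows "(\<lambda>k. fps_nth (phi_D_term \<phi> U psi F (eta1 \<phi> G U) k) l) sums fps_nth (eta2 \<phi> F G U) l"
proof -
  let ?t = "\<lambda>k. fps_nth (phi_D_term \<phi> U psi F (eta1 \<phi> G U) k) l"
  let ?R = "\<lambda>k. fps_nth (eta2 \<phi> ((zero_deriv ^^ k) F) G U) (l + k)"
  let ?s = "fps_nth (eta2 \<phi> F G U) l"
  have partial: "sum ?t {..<Suc k} = ?s - ?R k" for k
  proof (induction k)
    case 0
    show ?case by (simp add: phi_D_term_psi_nth)
  next
    case (Suc k)
    have "?R k = ?t (Suc k) + ?R (Suc k)"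
      using eta2_step[OF dominated_zero_deriv[OF F, of k] G, of "l + k"]
      by (simp add: phi_D_term_psi_nth)
    then show ?case using Suc by simp
  qed
  have "?R \<longlonglongrightarrow> 0"
  proof (rule remainder_tendsto_0[OF F, of _ "6 * norm (fps_op G U)"])
    show "cmod (?R k) \<le> 6 * norm (fps_op G U) * (real (l + k) + 1)\<^sup>2 *
        norm (fps_op ((zero_deriv ^^ k) F) U) * r ^ (l + k)" for k
      using norm_eta2_le[OF dominated_zero_deriv[OF F, of k] G, of "l + k"] by (simp only: mult_ac)
  qed simp
  then have "(\<lambda>k. ?s - ?R k) \<longlonglongrightarrow> ?s - 0"
    by (intro tendsto_diff tendsto_const)
  then have "(\<lambda>k. sum ?t {..<Suc k}) \<longlonglongrightarrow> ?s" unfolding partial by simp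
  then show ?thesis
    unfolding sums_def by (rule LIMSEQ_imp_Suc[of "\<lambda>n. sum ?t {..<n}"])
qed

lemma eta1_eq_phi_D_nth:
  assumes "dominated F C"
  shows "fps_nth (eta1 \<phi> F U) l =
    fps_nth (phi_D \<phi> U psi F (eta \<phi> U)) l + (if l = 0 then fps_nth F 0 else 0)"
  using sums_unique[OF eta1_sums[OF assms, of l]] by (simp only: phi_D_def fps_nth_Abs_fps diff_eq_eq)

text \<open>The series \<open>eta1 \<phi> G U\<close> and
  \<open>phi_D \<phi> U psi G (eta \<phi> U)\<close> differ only in degree 0, by
  \<open>G $ 0\<close>. The terms with \<open>k \<ge> 1\<close> read degrees at least 1, and
  \<open>psi\<close> kills the term \<open>k = 0\<close>.\<close>

lemma phi_D_term_eta1: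
  assumes "dominated G C"
  shows "fps_nth (phi_D_term \<phi> U psi F (phi_D \<phi> U psi G (eta \<phi> U)) k) l =
    fps_nth (phi_D_term \<phi> U psi F (eta1 \<phi> G U) k) l"
  by (simp add: phi_D_term_psi_nth eta1_eq_phi_D_nth[OF assms])

lemma phi_D_term_zero_deriv:
  "fps_nth (phi_D_term \<phi> U psi F (zero_deriv H) k) l = fps_nth (phi_D_term \<phi> U psi F H k) (Suc l)"
  by (simp add: phi_D_term_psi_nth zero_deriv_def)

lemma phi_D_converges_eta:
  "dominated F C \<Longrightarrow> phi_D_converges \<phi> U psi F (eta \<phi> U)"
  unfolding phi_D_converges_def using eta1_sums sums_summable by blast

lemma phi_D_converges_zero_deriv_eta:
  "dominated F C \<Longrightarrow> phi_D_converges \<phi> U psi F (zero_deriv (eta \<phi> U))"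
  using phi_D_converges_eta by (simp add: phi_D_converges_def phi_D_term_zero_deriv)

lemma eta2_eq_phi_D:
  assumes "dominated F C" "dominated G C'"
  shows "phi_D_converges \<phi> U psi F (phi_D \<phi> U psi G (eta \<phi> U))"
    and "eta2 \<phi> F G U = phi_D \<phi> U psi F (phi_D \<phi> U psi G (eta \<phi> U))"
proof -
  note sums = eta2_sums[OF assms]
  show "phi_D_converges \<phi> U psi F (phi_D \<phi> U psi G (eta \<phi> U))"
    unfolding phi_D_converges_def phi_D_term_eta1[OF assms(2)] using sums sums_summable by blast
  show "eta2 \<phi> F G U = phi_D \<phi> U psi F (phi_D \<phi> U psi G (eta \<phi> U))"
    unfolding phi_D_def[of \<phi> U psi F] phi_D_term_eta1[OF assms(2)]
    using sums_unique[OF sums] by (auto intro: fps_ext)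
qed

text \<open>Applying the operator to \<open>zero_deriv (eta \<phi> U)\<close> shifts its result on
  \<open>eta \<phi> U\<close> down by one degree. Multiplying by \<open>fps_X\<close> restores every
  coefficient except the constant one, which is added back.\<close>

lemma eta1_eq_phi_D:
  assumes "dominated F C"
  shows "eta1 \<phi> F U = fps_X * phi_D \<phi> U psi F (zero_deriv (eta \<phi> U))
    + fps_const (fps_nth (phi_D \<phi> U psi F (eta \<phi> U)) 0) + fps_const (fps_nth F 0)"
proof (rule fps_ext)
  fix l
  show "fps_nth (eta1 \<phi> F U) l = fps_nth (fps_X * phi_D \<phi> U psi F (zero_deriv (eta \<phi> U))
    + fps_const (fps_nth (phi_D \<phi> U psi F (eta \<phi> U)) 0) + fps_const (fps_nth F 0)) l"
    by (cases l) (simp_all add: eta1_eq_phi_D_nth[OF assms] phi_D_def phi_D_term_zero_deriv)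
qed

end

text \<open>The expansion converges at \<open>1 / \<rho>\<close>, inside the unit disc, so its terms
  there are bounded.\<close>

lemma analytic_on_unit_disc_coeff_bound:
  assumes "f analytic_on ball 0 1" "1 < \<rho>"
  obtains C where "\<And>i. cmod (fps_nth (fps_expansion f 0) i) \<le> C * \<rho> ^ i"
proof -
  have "fps_conv_radius (fps_expansion f 0) \<ge> 1"
    using conv_radius_fps_expansion[of f 0 1] assms(1) analytic_imp_holomorphic by (simp add: one_ereal_def)
  moreover have "ereal (norm (of_real (1 / \<rho>) :: complex)) < 1"
    using assms(2) by (simp add: one_ereal_def norm_divide)
  ultimately have "summable (\<lambda>n. fps_nth (fps_expansion f 0) n * of_real (1 / \<rho>) ^ n)"
    by (intro summable_fps) (metis less_le_trans)
  then have "Bseq (\<lambda>n. fps_nth (fps_expansion f 0) n * of_real (1 / \<rho>) ^ n)"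
    by (rule summable_LIMSEQ_zero[THEN convergentI, THEN convergent_imp_Bseq])
  then obtain C where "\<And>n. cmod (fps_nth (fps_expansion f 0) n * of_real (1 / \<rho>) ^ n) \<le> C"
    by (auto simp: Bseq_def)
  then have "cmod (fps_nth (fps_expansion f 0) n) * (1 / \<rho>) ^ n \<le> C" for n
    using assms(2) by (simp add: norm_mult norm_power norm_divide)
  then have "cmod (fps_nth (fps_expansion f 0) n) \<le> C * \<rho> ^ n" for n
    using assms(2) by (simp add: power_one_over field_simps)
  then show ?thesis using that by blast
qed

text \<open>The summand \<open>f 0\<close> accounts for what a sum starting at \<open>k = 1\<close>
  cannot see: for \<open>f = 1\<close> every zero derivative vanishes, while the constant
  coefficient of \<open>eta1\<close> is 1. The formula without this summand is stated for
  \<open>f 0 = 0\<close>. Convergence is asserted separately because an infinite sum denotes some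
  value even when it diverges.\<close>

theorem proposition3p4:
  fixes \<A> :: "('h::complex_hilbert_space \<Rightarrow>\<^sub>L 'h) set"
    and \<phi> :: "('h \<Rightarrow>\<^sub>L 'h) \<Rightarrow> complex"
    and U :: "'h \<Rightarrow>\<^sub>L 'h"
    and f g :: "complex \<Rightarrow> complex"
  assumes "W_star_probability_space \<A> \<phi>"
    and "f analytic_on ball 0 1" and "g analytic_on ball 0 1"
    and "U \<in> \<A>" and "op_le 0 U" and "op_less U id_blinfun"
  shows "let F = fps_expansion f 0; G = fps_expansion g 0; \<eta> = eta \<phi> U in
    (phi_D_converges \<phi> U psi G \<eta> \<and>
     phi_D_converges \<phi> U psi F (phi_D \<phi> U psi G \<eta>) \<and>
     eta2 \<phi> F G U = (phi_D \<phi> U psi F \<circ> phi_D \<phi> U psi G) \<eta>) \<and>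
    (phi_D_converges \<phi> U psi F (zero_deriv \<eta>) \<and>
     phi_D_converges \<phi> U psi F \<eta> \<and>
     (f 0 = 0 \<longrightarrow>
       eta1 \<phi> F U = fps_X * (phi_D \<phi> U psi F \<circ> zero_deriv) \<eta>
         + fps_const (fps_nth (phi_D \<phi> U psi F \<eta>) 0)) \<and>
     eta1 \<phi> F U = fps_X * (phi_D \<phi> U psi F \<circ> zero_deriv) \<eta>
       + fps_const (fps_nth (phi_D \<phi> U psi F \<eta>) 0) + fps_const (f 0))"
proof -
  obtain r where r: "0 < r" "r < 1" "norm U \<le> r"
    using op_less_id_imp_norm_less_1[OF assms(5,6)] by blast
  \<comment> \<open>The midpoint of 1 and \<open>1 / r\<close> satisfies both
    \<open>1 < \<rho>\<close> and \<open>\<rho> * r < 1\<close>.\<close>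
  define \<rho> where "\<rho> = (1 + 1 / r) / 2"
  have \<rho>: "1 < \<rho>" "\<rho> * r < 1" using r by (simp_all add: \<rho>_def field_simps)
  interpret positive_element \<A> \<phi> U r \<rho>
    by unfold_locales (use assms r \<rho> in \<open>simp_all add: op_le_def\<close>)
  obtain C where F: "dominated (fps_expansion f 0) C"
    using analytic_on_unit_disc_coeff_bound[OF assms(2) \<rho>(1)] unfolding dominated_def by metis
  obtain C' where G: "dominated (fps_expansion g 0) C'"
    using analytic_on_unit_disc_coeff_bound[OF assms(3) \<rho>(1)] unfolding dominated_def by metis
  have "fps_nth (fps_expansion f 0) 0 = f 0" by (simp add: fps_expansion_def)
  then show ?thesis
    using phi_D_converges_eta[OF F] phi_D_converges_eta[OF G] phi_D_converges_zero_deriv_eta[OF F]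
      eta2_eq_phi_D[OF F G] eta1_eq_phi_D[OF F]
    by (simp add: Let_def)
qed

end
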